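(* Let $K\subset\mathbb{R}^2$ be any compact set and let $u\in C^2_c(\mathbb{R}^2;\mathbb{R}^2)$ with $\operatorname{div}u=0$, $u=0$ and $\nabla u=0$ on $K$. Then there exists a sequence $\{u_k\}_k\subset C^\infty_c(\mathbb{R}^2;\mathbb{R}^2)$ with $\operatorname{div}u_k=0$ and $\operatorname{supp}u_k\subset\mathbb{R}^2\setminus K$, such that $u_k\to u$ in $C^1$. *)

theory Defs
  imports "HOL-Analysis.Analysis"
begin

fun Ck_scalar :: "nat \<Rightarrow> (real^'n \<Rightarrow> real) \<Rightarrow> bool" where
  "Ck_scalar 0 g = continuous_on UNIV g"
| "Ck_scalar (Suc k) g = (g differentiable_on UNIV \<and>
      (\<forall>j. Ck_scalar k (\<lambda>x. frechet_derivative g (at x) (axis j 1))))"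

definition Ck :: "nat \<Rightarrow> (real^'n \<Rightarrow> real^'m) \<Rightarrow> bool" where
  "Ck k f = (\<forall>i. Ck_scalar k (\<lambda>x. f x $ i))"

definition C_infinity :: "(real^'n \<Rightarrow> real^'m) \<Rightarrow> bool" where
  "C_infinity f = (\<forall>k. Ck k f)"

definition supp :: "(real^'n \<Rightarrow> real^'m) \<Rightarrow> (real^'n) set" where
  "supp f = closure {x. f x \<noteq> 0}"

definition divergence :: "(real^'n \<Rightarrow> real^'n) \<Rightarrow> real^'n \<Rightarrow> real" where
  "divergence u x = trace (jacobian u (at x))"

end

theory Submission
  imports Defs "HOL-Computational_Algebra.Polynomial"
begin

text \<open>
Write \<open>u = (\<partial>\<^sub>2 \<psi>, - \<partial>\<^sub>1 \<psi>)\<close> with a compactly supported stream function \<open>\<psi>\<close> of class \<open>C\<^sup>3\<close>. It suffices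
to approximate \<open>\<psi>\<close> in \<open>C\<^sup>2\<close> by smooth functions that are locally constant near \<open>K\<close>. The difficulty
is that \<open>\<psi>\<close> may take infinitely many values on \<open>K\<close>. Since \<open>D \<psi>\<close> and \<open>D\<^sup>2 \<psi>\<close> vanish on \<open>K\<close>, \<open>\<psi>\<close>
oscillates by only \<open>O(r\<^sup>3)\<close> on a ball of radius \<open>r\<close> around a point of \<open>K\<close>; hence the image of \<open>K\<close>
under \<open>\<psi>\<close> is covered by finitely many intervals of arbitrarily small total length, and a
1-Lipschitz function \<open>h\<close> that is uniformly close to the identity collapses each of them to a point.

Composing with \<open>h\<close> destroys the second derivatives of \<open>\<psi>\<close>, but \<open>H = h \<circ> \<psi>\<close> inherits the cubic
oscillation bound. At distance about \<open>r\<^sub>k = r\<^sub>0 / 2\<^sup>k\<close> from \<open>K\<close> we use the quasi-interpolant \<open>E\<^sub>k\<close> of \<open>H\<close>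
on a grid of mesh \<open>r\<^sub>k\<close>. The differences \<open>E\<^sub>k\<^sub>+\<^sub>1 - E\<^sub>k\<close>, cut off at scale \<open>r\<^sub>k\<close>, have second
derivatives \<open>O(r\<^sub>k)\<close>, and these sum to \<open>O(r\<^sub>0)\<close>. After finitely many scales the mesh is so fine
that \<open>E\<^sub>k\<close> is locally constant near \<open>K\<close>. Away from \<open>K\<close>, \<open>\<psi>\<close> is smoothed by gluing its
quadratic Taylor polynomials at the nodes of the grid of mesh \<open>r\<^sub>0\<close>.
\<close>

section \<open>Partial derivatives\<close>

text \<open>This is the expression used in \<open>Ck_scalar\<close>. Where \<open>f\<close> is not
  differentiable its value is an unspecified choice, hence the differentiability assumptions in the
  rules below.\<close>

definition pd :: "'n \<Rightarrow> (real^'n \<Rightarrow> real) \<Rightarrow> real^'n \<Rightarrow> real" where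
  "pd j f = (\<lambda>x. frechet_derivative f (at x) (axis j 1))"

lemma Ck_scalar_Suc:
  "Ck_scalar (Suc k) g \<longleftrightarrow> (\<forall>x. g differentiable at x) \<and> (\<forall>j. Ck_scalar k (pd j g))"
  by (auto simp: pd_def differentiable_on_def)

declare Ck_scalar.simps(2) [simp del]

lemma pd_eqI: "(f has_derivative f') (at x) \<Longrightarrow> pd j f x = f' (axis j 1)"
  unfolding pd_def by (metis frechet_derivative_at)

lemma has_derivative_pd:
  fixes f :: "real^'n \<Rightarrow> real"
  assumes "f differentiable at x"
  shows "(f has_derivative (\<lambda>h. \<Sum>j\<in>UNIV. h $ j * pd j f x)) (at x)"
proof -
  have d: "(f has_derivative frechet_derivative f (at x)) (at x)"
    using assms frechet_derivative_works by blast
  then have lin: "linear (frechet_derivative f (at x))"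
    using has_derivative_linear by blast
  have "frechet_derivative f (at x) h = (\<Sum>j\<in>UNIV. h $ j * pd j f x)" for h
  proof -
    have "frechet_derivative f (at x) h = frechet_derivative f (at x) (\<Sum>j\<in>UNIV. h $ j *\<^sub>R axis j 1)"
      by (simp only: vector_matrix_mul_rid basis_expansion flip: scalar_mult_eq_scaleR)
    then show ?thesis
      by (simp add: linear_sum[OF lin] linear_scale[OF lin] pd_def)
  qed
  then show ?thesis using d by presburger
qed

lemma Ck_scalar_continuous: "Ck_scalar k f \<Longrightarrow> continuous_on UNIV f"
  by (cases k) (auto simp: Ck_scalar_Suc intro!: continuous_at_imp_continuous_on differentiable_imp_continuous_within)

lemma Ck_scalar_SucD: "Ck_scalar (Suc k) f \<Longrightarrow> Ck_scalar k f"
  by (induction k arbitrary: f) (auto simp: Ck_scalar_Suc intro: Ck_scalar_continuous[of "Suc 0", unfolded Ck_scalar_Suc])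

lemma Ck_scalar_mono: "Ck_scalar k f \<Longrightarrow> l \<le> k \<Longrightarrow> Ck_scalar l f"
  by (induction k) (auto simp: le_Suc_eq dest: Ck_scalar_SucD)

lemma Ck_scalar_1D:
  assumes "Ck_scalar 1 f"
  shows "f differentiable at x" "continuous_on UNIV (pd j f)"
  using assms by (auto simp: One_nat_def Ck_scalar_Suc)

lemma Ck_scalar_2D:
  assumes "Ck_scalar 2 f"
  shows "f differentiable at x" "pd i f differentiable at x" "continuous_on UNIV (pd j (pd i f))"
  using assms by (auto simp: numeral_2_eq_2 Ck_scalar_Suc)

lemma pd_const: "pd j (\<lambda>x. c) = (\<lambda>x. 0)"
  by (rule ext, rule pd_eqI[of _ "\<lambda>h. 0", simplified]) simp

lemma pd_add:
  assumes "f differentiable at x" "g differentiable at x"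
  shows "pd j (\<lambda>x. f x + g x) x = pd j f x + pd j g x"
  using has_derivative_add[of f _ "at x" g] assms unfolding frechet_derivative_works pd_def
  by (metis frechet_derivative_at)

lemma pd_mult:
  assumes "f differentiable at x" "g differentiable at x"
  shows "pd j (\<lambda>x. f x * g x) x = pd j f x * g x + f x * pd j g x"
  using pd_eqI[OF has_derivative_mult[OF assms[unfolded frechet_derivative_works]], of j]
  by (simp add: pd_def)

lemma pd_minus:
  assumes "f differentiable at x"
  shows "pd j (\<lambda>x. - f x) x = - pd j f x"
  using pd_mult[of "\<lambda>x. -1" x f j] assms by (simp add: pd_const)

lemma pd_diff:
  assumes "f differentiable at x" "g differentiable at x"
  shows "pd j (\<lambda>x. f x - g x) x = pd j f x - pd j g x"
  using pd_add[of f x "\<lambda>x. - g x" j] assms by (simp add: pd_minus)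

lemma pd_sum:
  assumes "\<And>p. p \<in> I \<Longrightarrow> f p differentiable at x"
  shows "pd j (\<lambda>x. \<Sum>p\<in>I. f p x) x = (\<Sum>p\<in>I. pd j (f p) x)"
  using assms
  by (induction I rule: infinite_finite_induct) (auto simp: pd_const pd_add differentiable_sum)

lemma pd_inverse:
  assumes "f differentiable at x" "f x \<noteq> 0"
  shows "pd j (\<lambda>x. inverse (f x)) x = - (pd j f x * (inverse (f x) * inverse (f x)))"
proof -
  have "((\<lambda>x. inverse (f x)) has_derivative (\<lambda>h. - (inverse (f x) * frechet_derivative f (at x) h * inverse (f x)))) (at x)"
    by (rule Deriv.has_derivative_inverse[OF assms(2) assms(1)[unfolded frechet_derivative_works]])
  from pd_eqI[OF this, of j] show ?thesis by (simp add: pd_def)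
qed

lemma pd_affine:
  fixes f :: "real^'n \<Rightarrow> real"
  assumes "f differentiable at (a *\<^sub>R x + v)"
  shows "(\<lambda>x. f (a *\<^sub>R x + v)) differentiable at x"
    and "pd j (\<lambda>x. f (a *\<^sub>R x + v)) x = a * pd j f (a *\<^sub>R x + v)"
proof -
  let ?D = "frechet_derivative f (at (a *\<^sub>R x + v))"
  have lin: "linear ?D"
    using assms frechet_derivative_works has_derivative_linear by blast
  have "(f has_derivative ?D) (at (a *\<^sub>R x + v))"
    using assms frechet_derivative_works by blast
  then have *: "((\<lambda>x. f (a *\<^sub>R x + v)) has_derivative (\<lambda>h. ?D (a *\<^sub>R h))) (at x)"
    by (intro has_derivative_compose[of "\<lambda>x. a *\<^sub>R x + v" "\<lambda>h. a *\<^sub>R h" x UNIV f ?D])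
       (auto intro!: derivative_eq_intros)
  then show "(\<lambda>x. f (a *\<^sub>R x + v)) differentiable at x"
    using differentiable_def by blast
  show "pd j (\<lambda>x. f (a *\<^sub>R x + v)) x = a * pd j f (a *\<^sub>R x + v)"
    using pd_eqI[OF *, of j] by (simp add: linear_scale[OF lin] pd_def)
qed

lemma pd_coordinate:
  fixes x :: "real^'n"
  assumes "(g has_real_derivative g') (at (x $ i))"
  shows "(\<lambda>x. g (x $ i)) differentiable at x"
    and "pd j (\<lambda>x. g (x $ i)) x = (if i = j then g' else 0)"
proof -
  have *: "((\<lambda>x. g (x $ i)) has_derivative (\<lambda>h. g' * h $ i)) (at x)"
    using assms by (intro has_derivative_compose[of "\<lambda>x. x $ i" "\<lambda>h. h $ i" x UNIV g "\<lambda>h. g' * h"])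
      (auto simp: has_field_derivative_def intro!: bounded_linear_imp_has_derivative bounded_linear_vec_nth)
  then show "(\<lambda>x. g (x $ i)) differentiable at x"
    using differentiable_def by blast
  show "pd j (\<lambda>x. g (x $ i)) x = (if i = j then g' else 0)"
    using pd_eqI[OF *, of j] by (simp add: axis_def)
qed

text \<open>Functions that agree near \<open>x\<close> have the same candidate derivatives at
  \<open>x\<close>, so the choice in \<open>frechet_derivative\<close> coincides even where no
  derivative exists.\<close>

lemma pd_cong_open:
  assumes "open S" "x \<in> S" "\<And>y. y \<in> S \<Longrightarrow> f y = g y"
  shows "pd j f x = pd j g x"
proof -
  have "(f has_derivative D) (at x) \<longleftrightarrow> (g has_derivative D) (at x)" for D
    using has_derivative_transform_within_open[OF _ assms(1,2), of f D UNIV g]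
      has_derivative_transform_within_open[OF _ assms(1,2), of g D UNIV f] assms(3) by auto
  then show ?thesis by (simp add: pd_def frechet_derivative_def)
qed

section \<open>Closure properties of the classes C^k\<close>

lemma Ck_scalar_const: "Ck_scalar k (\<lambda>x. c)"
  by (induction k arbitrary: c) (auto simp: Ck_scalar_Suc pd_const)

lemma Ck_scalar_add: "Ck_scalar k f \<Longrightarrow> Ck_scalar k g \<Longrightarrow> Ck_scalar k (\<lambda>x. f x + g x)"
proof (induction k arbitrary: f g)
  case (Suc k)
  then have "pd j (\<lambda>x. f x + g x) = (\<lambda>x. pd j f x + pd j g x)" for j
    by (auto simp: Ck_scalar_Suc pd_add)
  with Suc show ?case by (auto simp: Ck_scalar_Suc)
qed (simp add: continuous_on_add)

lemma Ck_scalar_mult: "Ck_scalar k f \<Longrightarrow> Ck_scalar k g \<Longrightarrow> Ck_scalar k (\<lambda>x. f x * g x)"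
proof (induction k arbitrary: f g)
  case (Suc k)
  then have "pd j (\<lambda>x. f x * g x) = (\<lambda>x. pd j f x * g x + f x * pd j g x)" for j
    by (auto simp: Ck_scalar_Suc pd_mult)
  moreover have "Ck_scalar k f" "Ck_scalar k g" using Suc.prems by (auto intro: Ck_scalar_SucD)
  ultimately show ?case using Suc by (auto simp: Ck_scalar_Suc intro!: Ck_scalar_add)
qed (simp add: continuous_on_mult)

lemma Ck_scalar_minus: "Ck_scalar k f \<Longrightarrow> Ck_scalar k (\<lambda>x. - f x)"
  using Ck_scalar_mult[OF Ck_scalar_const[of k "-1"], of f] by simp

lemma Ck_scalar_diff: "Ck_scalar k f \<Longrightarrow> Ck_scalar k g \<Longrightarrow> Ck_scalar k (\<lambda>x. f x - g x)"
  using Ck_scalar_add[OF _ Ck_scalar_minus, of k f g] by simp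

lemma Ck_scalar_sum: "(\<And>p. p \<in> I \<Longrightarrow> Ck_scalar k (f p)) \<Longrightarrow> Ck_scalar k (\<lambda>x. \<Sum>p\<in>I. f p x)"
  by (induction I rule: infinite_finite_induct) (auto intro: Ck_scalar_const Ck_scalar_add)

lemma Ck_scalar_inverse:
  assumes "\<And>x. f x \<noteq> 0"
  shows "Ck_scalar k f \<Longrightarrow> Ck_scalar k (\<lambda>x. inverse (f x))"
proof (induction k)
  case 0
  then show ?case using assms by (simp add: continuous_on_inverse)
next
  case (Suc k)
  then have "pd j (\<lambda>x. inverse (f x)) = (\<lambda>x. - (pd j f x * (inverse (f x) * inverse (f x))))" for j
    using assms by (auto simp: Ck_scalar_Suc pd_inverse)
  moreover have "Ck_scalar k f" using Suc.prems by (auto intro: Ck_scalar_SucD)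
  ultimately show ?case using Suc assms
    by (auto simp: Ck_scalar_Suc intro!: Ck_scalar_minus Ck_scalar_mult differentiable_inverse)
qed

lemma Ck_scalar_affine: "Ck_scalar k f \<Longrightarrow> Ck_scalar k (\<lambda>x. f (a *\<^sub>R x + v))"
proof (induction k arbitrary: f)
  case 0
  have "continuous_on UNIV (\<lambda>x. a *\<^sub>R x + v)" by (intro continuous_intros)
  then show ?case using 0 continuous_on_compose2[of UNIV f UNIV "\<lambda>x. a *\<^sub>R x + v"] by simp
next
  case (Suc k)
  then have "pd j (\<lambda>x. f (a *\<^sub>R x + v)) = (\<lambda>x. a * pd j f (a *\<^sub>R x + v))" for j
    by (auto simp: Ck_scalar_Suc pd_affine)
  with Suc show ?case by (auto simp: Ck_scalar_Suc pd_affine intro!: Ck_scalar_mult Ck_scalar_const)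
qed

lemma Ck_scalar_nth: "Ck_scalar k (\<lambda>x::real^'n. x $ i)"
proof (cases k)
  case 0
  then show ?thesis by (simp add: continuous_on_component continuous_on_id)
next
  case (Suc l)
  have *: "((\<lambda>t. t) has_real_derivative 1) (at t)" for t by (auto intro: derivative_eq_intros)
  have "pd j (\<lambda>x::real^'n. x $ i) = (\<lambda>x. if i = j then 1 else 0)" for j
    by (intro ext) (simp add: pd_coordinate(2)[OF *])
  then show ?thesis using pd_coordinate(1)[OF *] by (auto simp: Suc Ck_scalar_Suc Ck_scalar_const)
qed

section \<open>Symmetry of second partial derivatives\<close>

lemma DERIV_line:
  fixes f :: "real^'n \<Rightarrow> real"
  assumes "f differentiable at (x + t *\<^sub>R axis i 1)"
  shows "((\<lambda>t. f (x + t *\<^sub>R axis i 1)) has_real_derivative pd i f (x + t *\<^sub>R axis i 1)) (at t)"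
proof -
  let ?D = "frechet_derivative f (at (x + t *\<^sub>R axis i 1))"
  have d: "(f has_derivative ?D) (at (x + t *\<^sub>R axis i 1))"
    using assms frechet_derivative_works by blast
  then have lin: "linear ?D" using has_derivative_linear by blast
  have "((\<lambda>t. f (x + t *\<^sub>R axis i 1)) has_derivative (\<lambda>h. ?D (h *\<^sub>R axis i 1))) (at t)"
    by (rule has_derivative_compose[of "\<lambda>t. x + t *\<^sub>R axis i 1" "\<lambda>h. h *\<^sub>R axis i 1" t UNIV f, OF _ d])
       (auto intro!: derivative_eq_intros)
  moreover have "(\<lambda>h. ?D (h *\<^sub>R axis i 1)) = (*) (pd i f (x + t *\<^sub>R axis i 1))"
    by (auto simp: linear_scale[OF lin] pd_def)
  ultimately show ?thesis
    by (simp add: has_field_derivative_def)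
qed

text \<open>Two applications of the mean value theorem, first along axis \<open>i\<close>, then
  along axis \<open>j\<close>. The second difference on the left is symmetric in \<open>i\<close>
  and \<open>j\<close>, which \<open>pd_commute\<close> exploits.\<close>

lemma second_difference_eq:
  fixes f :: "real^'n \<Rightarrow> real" and i j
  assumes f: "Ck_scalar 2 f" and h: "h > 0"
  defines "e \<equiv> \<lambda>k t. t *\<^sub>R (axis k 1 :: real^'n)"
  shows "\<exists>\<xi>. norm (\<xi> - x) \<le> 2 * h \<and>
    f (x + e i h + e j h) - f (x + e i h) - f (x + e j h) + f x = h * h * pd j (pd i f) \<xi>"
proof -
  let ?G = "\<lambda>s. f (x + e j h + e i s) - f (x + e i s)"
  have "\<exists>s. 0 < s \<and> s < h \<and> ?G h - ?G 0 = (h - 0) * (pd i f (x + e j h + e i s) - pd i f (x + e i s))"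
    using h Ck_scalar_2D[OF f] unfolding e_def
    by (intro MVT2) (auto intro!: derivative_intros DERIV_line)
  then obtain s where s: "0 < s" "s < h"
    "?G h - ?G 0 = h * (pd i f (x + e j h + e i s) - pd i f (x + e i s))" by auto
  let ?F = "\<lambda>t. pd i f (x + e i s + e j t)"
  have "\<exists>t. 0 < t \<and> t < h \<and> ?F h - ?F 0 = (h - 0) * pd j (pd i f) (x + e i s + e j t)"
    using h Ck_scalar_2D[OF f] unfolding e_def by (intro MVT2) (auto intro!: DERIV_line)
  then obtain t where t: "0 < t" "t < h" "?F h - ?F 0 = h * pd j (pd i f) (x + e i s + e j t)" by auto
  have "norm (x + e i s + e j t - x) \<le> \<bar>s\<bar> + \<bar>t\<bar>"
    using norm_triangle_ineq[of "e i s" "e j t"] by (simp add: e_def)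
  moreover have "f (x + e i h + e j h) - f (x + e i h) - f (x + e j h) + f x
      = h * h * pd j (pd i f) (x + e i s + e j t)"
    using s(3) t(3) by (simp add: e_def algebra_simps)
  ultimately show ?thesis using s t by (intro exI[of _ "x + e i s + e j t"]) auto
qed

lemma pd_commute:
  fixes f :: "real^'n \<Rightarrow> real"
  assumes f: "Ck_scalar 2 f"
  shows "pd i (pd j f) x = pd j (pd i f) x"
proof -
  have *: "\<exists>d>0. \<forall>y. norm (y - x) < d \<longrightarrow> \<bar>pd k (pd l f) y - pd k (pd l f) x\<bar> < \<epsilon>" if "\<epsilon> > 0" for k l \<epsilon>
    using Ck_scalar_2D(3)[OF f, of k l] that by (auto simp: continuous_on_iff dist_norm)
  have "\<bar>pd i (pd j f) x - pd j (pd i f) x\<bar> \<le> \<epsilon>" if "\<epsilon> > 0" for \<epsilon>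
  proof -
    obtain d1 where d1: "d1 > 0" "\<And>y. norm (y - x) < d1 \<Longrightarrow> \<bar>pd i (pd j f) y - pd i (pd j f) x\<bar> < \<epsilon>/2"
      using *[of "\<epsilon>/2" i j] \<open>\<epsilon> > 0\<close> by auto
    obtain d2 where d2: "d2 > 0" "\<And>y. norm (y - x) < d2 \<Longrightarrow> \<bar>pd j (pd i f) y - pd j (pd i f) x\<bar> < \<epsilon>/2"
      using *[of "\<epsilon>/2" j i] \<open>\<epsilon> > 0\<close> by auto
    \<comment> \<open>Every point within \<open>2 * h\<close> of \<open>x\<close> lies in both
      continuity neighbourhoods.\<close>
    define h where "h = min d1 d2 / 3"
    have h: "h > 0" "2 * h < d1" "2 * h < d2" using d1 d2 by (auto simp: h_def)
    obtain y where y: "norm (y - x) \<le> 2 * h"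
      "f (x + h *\<^sub>R axis i 1 + h *\<^sub>R axis j 1) - f (x + h *\<^sub>R axis i 1) - f (x + h *\<^sub>R axis j 1) + f x
        = h * h * pd j (pd i f) y"
      using second_difference_eq[OF f h(1), of x i j] by blast
    obtain z where z: "norm (z - x) \<le> 2 * h"
      "f (x + h *\<^sub>R axis j 1 + h *\<^sub>R axis i 1) - f (x + h *\<^sub>R axis j 1) - f (x + h *\<^sub>R axis i 1) + f x
        = h * h * pd i (pd j f) z"
      using second_difference_eq[OF f h(1), of x j i] by blast
    have "h * h * pd j (pd i f) y = h * h * pd i (pd j f) z"
      unfolding y(2)[symmetric] z(2)[symmetric] by (simp add: algebra_simps)
    then have "pd j (pd i f) y = pd i (pd j f) z" using h(1) by simp
    then show ?thesis using d1(2)[of z] d2(2)[of y] y z h by linarith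
  qed
  then show ?thesis using field_le_epsilon[of "\<bar>pd i (pd j f) x - pd j (pd i f) x\<bar>" 0] by simp
qed

section \<open>A smooth partition of unity on a grid\<close>

text \<open>A class of functions, flat at the origin, that is closed under differentiation.\<close>

definition flat :: "real poly \<Rightarrow> real \<Rightarrow> real" where
  "flat p t = (if t > 0 then poly p (1 / t) * exp (- (1 / t)) else 0)"

lemma tendsto_poly_exp_minus: "((\<lambda>t::real. poly p t * exp (- t)) \<longlongrightarrow> 0) at_top"
proof -
  have "((\<lambda>t. \<Sum>i\<le>degree p. coeff p i * (t ^ i / exp t)) \<longlongrightarrow> (\<Sum>i\<le>degree p. coeff p i * 0)) at_top"
    by (intro tendsto_intros tendsto_power_div_exp_0)
  then show ?thesis
    by (simp add: poly_altdef exp_minus divide_inverse sum_distrib_right mult.assoc)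
qed

text \<open>Under s = 1/t, differentiation in t is -s^2 d/ds, which turns p(s) exp(-s) into s^2
  (p(s) - p'(s)) exp(-s). At t = 0 the difference quotient from the right is again a polynomial in s
  times exp(-s) and tends to 0.\<close>

lemma DERIV_flat:
  "(flat p has_real_derivative flat ([:0, 0, 1:] * (p - pderiv p)) t) (at t)"
proof -
  consider "t < 0" | "t = 0" | "t > 0" by linarith
  then show ?thesis
  proof cases
    case 1
    have "(flat p has_real_derivative 0) (at t)"
      by (rule has_field_derivative_transform_within_open[of "\<lambda>_. 0" 0 t "{..<0}"])
         (use 1 in \<open>auto simp: flat_def\<close>)
    then show ?thesis using 1 by (simp add: flat_def)
  next
    case 3
    have "((\<lambda>t. poly p (1 / t) * exp (- (1 / t))) has_real_derivative flat ([:0, 0, 1:] * (p - pderiv p)) t) (at t)"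
      using 3 by (auto intro!: derivative_eq_intros DERIV_chain'[OF _ poly_DERIV] simp: flat_def)
        (simp add: field_simps power2_eq_square)
    then show ?thesis
      using 3 by (auto elim!: has_field_derivative_transform_within_open[where S="{0<..}"] simp: flat_def)
  next
    case 2
    have "((\<lambda>h. poly (pCons 0 p) (inverse h) * exp (- inverse h)) \<longlongrightarrow> 0) (at_right 0)"
      by (rule filterlim_compose[OF tendsto_poly_exp_minus filterlim_inverse_at_top_right])
    then have "((\<lambda>h. flat p h / h) \<longlongrightarrow> 0) (at_right 0)"
      by (rule Lim_transform_eventually)
         (auto simp: flat_def eventually_at_right_less divide_inverse intro!: eventually_at_rightI[of 0 1])
    moreover have "((\<lambda>h. flat p h / h) \<longlongrightarrow> 0) (at_left 0)"
      by (rule Lim_transform_eventually[of "\<lambda>_. 0"])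
         (auto simp: flat_def intro!: eventually_at_leftI[of "-1"])
    ultimately have "((\<lambda>h. flat p h / h) \<longlongrightarrow> 0) (at 0)"
      by (simp add: filterlim_split_at)
    then show ?thesis using 2 by (simp add: has_field_derivative_iff flat_def)
  qed
qed

lemma Ck_scalar_flat: "Ck_scalar k (\<lambda>x::real^'n. flat p (x $ i))"
proof (induction k arbitrary: p)
  case 0
  have "continuous_on UNIV (flat p)"
    using DERIV_flat DERIV_isCont continuous_at_imp_continuous_on by blast
  then show ?case
    using continuous_on_compose2[of UNIV "flat p" UNIV "\<lambda>x::real^'n. x $ i"]
    by (simp add: continuous_on_component continuous_on_id)
next
  case (Suc k)
  have "pd j (\<lambda>x::real^'n. flat p (x $ i))
      = (\<lambda>x. if i = j then flat ([:0, 0, 1:] * (p - pderiv p)) (x $ i) else 0)" for j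
    using pd_coordinate(2)[OF DERIV_flat] by fast
  then have "Ck_scalar k (pd j (\<lambda>x::real^'n. flat p (x $ i)))" for j
    using Suc Ck_scalar_const[of k 0] by (cases "i = j") simp_all
  then show ?case
    by (simp add: Ck_scalar_Suc pd_coordinate(1)[OF DERIV_flat])
qed

definition smooth_step :: "real \<Rightarrow> real" where
  "smooth_step t = flat 1 t * inverse (flat 1 t + flat 1 (1 - t))"

lemma smooth_step_eq_0: "t \<le> 0 \<Longrightarrow> smooth_step t = 0"
  by (simp add: smooth_step_def flat_def)

lemma smooth_step_eq_1: "t \<ge> 1 \<Longrightarrow> smooth_step t = 1"
  by (simp add: smooth_step_def flat_def)

lemma Ck_scalar_smooth_step: "Ck_scalar k (\<lambda>x::real^'n. smooth_step (x $ i))"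
proof -
  have "Ck_scalar k (\<lambda>x::real^'n. flat 1 (1 - x $ i))"
    using Ck_scalar_affine[OF Ck_scalar_flat[of k 1 i], of "-1" "vec 1"] by simp
  moreover have "flat 1 t + flat 1 (1 - t) \<noteq> 0" for t
  proof -
    \<comment> \<open>One of \<open>t\<close> and \<open>1 - t\<close> is positive, and
      \<open>flat 1\<close> is positive on positive arguments.\<close>
    have "flat 1 t + flat 1 (1 - t) > 0"
      by (cases "t > 0"; cases "1 - t > 0") (auto simp: flat_def add_pos_pos)
    then show ?thesis by simp
  qed
  ultimately show ?thesis unfolding smooth_step_def
    by (intro Ck_scalar_mult Ck_scalar_inverse Ck_scalar_add Ck_scalar_flat)
qed

text \<open>Each factor is a difference of consecutive unit translates of
  \<open>smooth_step\<close>: it vanishes outside (-1, 1), and sums of its integer translates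
  telescope.\<close>

definition bump :: "real^2 \<Rightarrow> real" where
  "bump x = (smooth_step (x $ 1 + 1) - smooth_step (x $ 1)) * (smooth_step (x $ 2 + 1) - smooth_step (x $ 2))"

lemma Ck_scalar_bump: "Ck_scalar k bump"
proof -
  have "Ck_scalar k (\<lambda>x::real^2. smooth_step (x $ i + 1))" for i
    using Ck_scalar_affine[OF Ck_scalar_smooth_step[of k i], of "1" "vec 1"] by simp
  then show ?thesis unfolding bump_def
    by (intro Ck_scalar_mult Ck_scalar_diff Ck_scalar_smooth_step)
qed

lemma norm_le_2: "norm (x::real^2) \<le> \<bar>x $ 1\<bar> + \<bar>x $ 2\<bar>"
  using norm_le_l1_cart[of x] by (simp add: sum_2)

lemma bump_eq_0: "norm x > 2 \<Longrightarrow> bump x = 0"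
proof -
  assume "norm x > 2"
  then have "\<bar>x $ 1\<bar> \<ge> 1 \<or> \<bar>x $ 2\<bar> \<ge> 1" using norm_le_2[of x] by linarith
  then show ?thesis
    by (auto simp: bump_def abs_if smooth_step_eq_0 smooth_step_eq_1 split: if_splits)
qed

lemma sum_smooth_step:
  "(\<Sum>m\<in>{- int N..int N}. smooth_step (t - of_int m + 1) - smooth_step (t - of_int m))
     = smooth_step (t + N + 1) - smooth_step (t - N)"
proof (induction N)
  case (Suc N)
  have "{- int (Suc N)..int (Suc N)} = insert (- int (Suc N)) (insert (int (Suc N)) {- int N..int N})"
    by auto
  then show ?case using Suc by (simp add: algebra_simps)
qed simp

section \<open>Rescaled cells on a square grid\<close>

definition node :: "int \<times> int \<Rightarrow> real^2" where
  "node p = vector [of_int (fst p), of_int (snd p)]"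

definition cell :: "real \<Rightarrow> int \<times> int \<Rightarrow> real^2 \<Rightarrow> real" where
  "cell r p x = bump (inverse r *\<^sub>R x + - node p)"

definition grid :: "nat \<Rightarrow> (int \<times> int) set" where
  "grid N = {- int N..int N} \<times> {- int N..int N}"

lemma finite_grid [simp]: "finite (grid N)"
  by (simp add: grid_def)

lemma card_grid: "card (grid N) = (2 * N + 1)\<^sup>2"
  by (simp add: grid_def power2_eq_square card_cartesian_product nat_add_distrib nat_mult_distrib flip: mult_2)

lemma Ck_scalar_cell: "Ck_scalar k (cell r p)"
  unfolding cell_def by (intro Ck_scalar_affine Ck_scalar_bump)

text \<open>The sum factors into two telescoping sums. The bound on \<open>x\<close> puts the two
  surviving steps of each coordinate on the plateaus 1 and 0.\<close>

lemma sum_cell_eq_1: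
  assumes "r > 0" and x: "\<And>i. \<bar>x $ i\<bar> \<le> N * r"
  shows "(\<Sum>p\<in>grid N. cell r p x) = 1"
proof -
  let ?s = "\<lambda>t m. smooth_step (t - of_int m + 1) - smooth_step (t - of_int m)"
  have 1: "(\<Sum>m\<in>{- int N..int N}. ?s (x $ i / r) m) = 1" for i
  proof -
    have "- N \<le> x $ i / r" "x $ i / r \<le> N"
      using x[of i] \<open>r > 0\<close> by (auto simp: field_simps abs_le_iff)
    then show ?thesis by (simp add: sum_smooth_step smooth_step_eq_0 smooth_step_eq_1)
  qed
  have "(\<Sum>p\<in>grid N. cell r p x) = (\<Sum>(m, n)\<in>grid N. ?s (x $ 1 / r) m * ?s (x $ 2 / r) n)"
    by (intro sum.cong) (auto simp: cell_def bump_def node_def divide_inverse mult.commute)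
  also have "\<dots> = (\<Sum>m\<in>{- int N..int N}. ?s (x $ 1 / r) m) * (\<Sum>n\<in>{- int N..int N}. ?s (x $ 2 / r) n)"
    by (simp add: grid_def sum_product sum.cartesian_product)
  also have "\<dots> = 1" by (simp only: 1)
  finally show ?thesis .
qed

text \<open>Each coordinate of a near node has at most five possible values. The bound is
  independent of \<open>r\<close> and \<open>N\<close>, which makes the later constants uniform over
  all scales.\<close>

lemma card_near_nodes:
  assumes "r > 0"
  shows "card {p\<in>grid N. norm (x - r *\<^sub>R node p) \<le> 2 * r} \<le> 25"
proof -
  have *: "\<lfloor>x $ i / r\<rfloor> - 2 \<le> m \<and> m \<le> \<lfloor>x $ i / r\<rfloor> + 2"
    if "\<bar>x $ i - r * of_int m\<bar> \<le> 2 * r" for i m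
  proof -
    have "x $ i / r \<le> of_int m + 2" "of_int m \<le> x $ i / r + 2"
      using that \<open>r > 0\<close> by (auto simp: field_simps abs_le_iff)
    then show ?thesis by linarith
  qed
  have "{p\<in>grid N. norm (x - r *\<^sub>R node p) \<le> 2 * r}
      \<subseteq> {\<lfloor>x $ 1 / r\<rfloor> - 2..\<lfloor>x $ 1 / r\<rfloor> + 2} \<times> {\<lfloor>x $ 2 / r\<rfloor> - 2..\<lfloor>x $ 2 / r\<rfloor> + 2}" (is "?A \<subseteq> ?B")
  proof
    fix p assume "p \<in> ?A"
    then have "\<bar>(x - r *\<^sub>R node p) $ i\<bar> \<le> 2 * r" for i
      using component_le_norm_cart[of "x - r *\<^sub>R node p" i] by auto
    from this[of 1] this[of 2] show "p \<in> ?B"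
      by (cases p) (auto simp: node_def dest!: *)
  qed
  then have "card ?A \<le> card ?B" by (intro card_mono) auto
  also have "\<dots> = 25" by (simp add: card_cartesian_product)
  finally show ?thesis .
qed

section \<open>Scaled bounds on two-jets\<close>

text \<open>The weights \<open>r\<close> and \<open>r\<^sup>2\<close> are those under which the bound is stable under products.\<close>

definition jet_bound :: "real \<Rightarrow> real \<Rightarrow> (real^'n \<Rightarrow> real) \<Rightarrow> real^'n \<Rightarrow> bool" where
  "jet_bound r M f x \<longleftrightarrow> \<bar>f x\<bar> \<le> M \<and> (\<forall>i. \<bar>pd i f x\<bar> * r \<le> M) \<and> (\<forall>i j. \<bar>pd i (pd j f) x\<bar> * r\<^sup>2 \<le> M)"

lemma jet_bound_mono: "jet_bound r M f x \<Longrightarrow> M \<le> M' \<Longrightarrow> jet_bound r M' f x"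
  unfolding jet_bound_def by (meson order_trans)

lemma jet_bound_scale:
  assumes "jet_bound r M f x" "0 \<le> s" "s \<le> r"
  shows "jet_bound s M f x"
proof -
  have "\<bar>a\<bar> * s \<le> \<bar>a\<bar> * r" "\<bar>a\<bar> * s\<^sup>2 \<le> \<bar>a\<bar> * r\<^sup>2" for a :: real
    using assms(2,3) by (auto intro!: mult_left_mono power_mono)
  with assms(1) show ?thesis unfolding jet_bound_def by (meson order_trans)
qed

text \<open>For \<open>r \<le> 1\<close> the weight \<open>r\<^sup>2\<close> is the smallest one. A
  weighted bound O(r^3) thus becomes an unweighted bound O(r) on the whole two-jet, which is how the
  lemma is used.\<close>

lemma jet_bound_unscale:
  assumes "jet_bound r M f x" "0 < r" "r \<le> 1"
  shows "jet_bound 1 (M / r\<^sup>2) f x"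
proof -
  have r: "r\<^sup>2 \<le> 1" "r\<^sup>2 \<le> r" using assms(2,3) by (auto simp: power2_eq_square mult_le_one)
  have "\<bar>a\<bar> * r\<^sup>2 \<le> \<bar>a\<bar>" "\<bar>a\<bar> * r\<^sup>2 \<le> \<bar>a\<bar> * r" for a :: real
    using mult_left_mono[OF r(1), of "\<bar>a\<bar>"] mult_left_mono[OF r(2), of "\<bar>a\<bar>"] by auto
  with assms show ?thesis unfolding jet_bound_def
    by (auto simp: pos_le_divide_eq intro: order_trans)
qed

lemma jet_bound_cong_open:
  assumes "open S" "x \<in> S" and eq: "\<And>y. y \<in> S \<Longrightarrow> f y = g y"
  shows "jet_bound r M f x \<longleftrightarrow> jet_bound r M g x"
proof -
  have "pd i f y = pd i g y" if "y \<in> S" for i y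
    using pd_cong_open[OF \<open>open S\<close> that eq] .
  moreover from this have "pd i (pd j f) x = pd i (pd j g) x" for i j
    using pd_cong_open[OF assms(1,2)] by blast
  ultimately show ?thesis using assms(2) eq unfolding jet_bound_def by simp
qed

lemma jet_bound_const: "\<bar>c\<bar> \<le> M \<Longrightarrow> jet_bound r M (\<lambda>x. c) x"
  unfolding jet_bound_def by (auto simp: pd_const)

lemma pd_pd_add:
  assumes "Ck_scalar 2 f" "Ck_scalar 2 g"
  shows "pd i (pd j (\<lambda>x. f x + g x)) x = pd i (pd j f) x + pd i (pd j g) x"
proof -
  have "pd j (\<lambda>x. f x + g x) = (\<lambda>x. pd j f x + pd j g x)"
    using Ck_scalar_2D[OF assms(1)] Ck_scalar_2D[OF assms(2)] by (auto simp: pd_add)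
  then show ?thesis using Ck_scalar_2D[OF assms(1)] Ck_scalar_2D[OF assms(2)] by (simp add: pd_add)
qed

lemma pd_pd_mult:
  assumes "Ck_scalar 2 f" "Ck_scalar 2 g"
  shows "pd i (pd j (\<lambda>x. f x * g x)) x =
    pd i (pd j f) x * g x + pd j f x * pd i g x + (pd i f x * pd j g x + f x * pd i (pd j g) x)"
proof -
  have "pd j (\<lambda>x. f x * g x) = (\<lambda>x. pd j f x * g x + f x * pd j g x)"
    using Ck_scalar_2D[OF assms(1)] Ck_scalar_2D[OF assms(2)] by (auto simp: pd_mult)
  then show ?thesis using Ck_scalar_2D[OF assms(1)] Ck_scalar_2D[OF assms(2)]
    by (simp add: pd_add pd_mult)
qed

lemma jet_bound_add:
  assumes "Ck_scalar 2 f" "Ck_scalar 2 g" "jet_bound r M f x" "jet_bound r M' g x" "0 \<le> r"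
  shows "jet_bound r (M + M') (\<lambda>x. f x + g x) x"
proof -
  have *: "\<bar>a + b\<bar> * s \<le> M + M'" if "\<bar>a\<bar> * s \<le> M" "\<bar>b\<bar> * s \<le> M'" "0 \<le> s" for a b s
    using that mult_right_mono[OF abs_triangle_ineq[of a b], of s] by (simp add: algebra_simps)
  show ?thesis using assms(3-) *[of _ 1] *[of _ r] *[of _ "r\<^sup>2"] Ck_scalar_2D[OF assms(1)] Ck_scalar_2D[OF assms(2)]
    unfolding jet_bound_def by (auto simp: pd_add pd_pd_add[OF assms(1,2)])
qed

text \<open>The factor 4 counts the terms of the second-order Leibniz rule; in each of them the
  weights of the two factors multiply to \<open>r\<^sup>2\<close>.\<close>

lemma jet_bound_mult:
  assumes "Ck_scalar 2 f" "Ck_scalar 2 g" "jet_bound r M f x" "jet_bound r M' g x" "0 \<le> r"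
  shows "jet_bound r (4 * M * M') (\<lambda>x. f x * g x) x"
proof -
  have "0 \<le> M" "0 \<le> M'" using assms(3,4) unfolding jet_bound_def by (meson abs_ge_zero order_trans)+
  then have *: "\<bar>a * b\<bar> * (s * t) \<le> M * M'" if "\<bar>a\<bar> * s \<le> M" "\<bar>b\<bar> * t \<le> M'" "0 \<le> s" "0 \<le> t" for a b s t
    using mult_mono[OF that(1,2)] that by (simp add: abs_mult ac_simps)
  have fg: "\<bar>f x\<bar> * 1 \<le> M" "\<bar>pd i f x\<bar> * r \<le> M" "\<bar>pd i (pd j f) x\<bar> * (r * r) \<le> M"
      "\<bar>g x\<bar> * 1 \<le> M'" "\<bar>pd i g x\<bar> * r \<le> M'" "\<bar>pd i (pd j g) x\<bar> * (r * r) \<le> M'" for i j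
    using assms(3,4) by (auto simp: jet_bound_def power2_eq_square)
  have tri: "\<bar>a + b\<bar> * s \<le> A + B" if "\<bar>a\<bar> * s \<le> A" "\<bar>b\<bar> * s \<le> B" "0 \<le> s" for a b s A B :: real
    using that mult_right_mono[OF abs_triangle_ineq[of a b], of s] by (simp add: algebra_simps)
  have 0: "\<bar>f x * g x\<bar> \<le> M * M'"
    using *[OF fg(1) fg(4)] by simp
  have 1: "\<bar>pd i f x * g x + f x * pd i g x\<bar> * r \<le> M * M' + M * M'" for i
    using *[OF fg(2)[of i] fg(4)] *[OF fg(1) fg(5)[of i]] \<open>0 \<le> r\<close> by (intro tri) simp_all
  have 2: "\<bar>pd i (pd j f) x * g x + pd j f x * pd i g x + (pd i f x * pd j g x + f x * pd i (pd j g) x)\<bar> * (r * r)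
      \<le> M * M' + M * M' + (M * M' + M * M')" for i j
    using *[OF fg(3)[of i j] fg(4)] *[OF fg(1) fg(6)[of i j]]
      *[OF fg(2)[of i] fg(5)[of j]] *[OF fg(2)[of j] fg(5)[of i]] \<open>0 \<le> r\<close>
    by (intro tri) simp_all
  have "M * M' \<ge> 0" using \<open>0 \<le> M\<close> \<open>0 \<le> M'\<close> by simp
  then have "\<bar>f x * g x\<bar> \<le> 4 * M * M'" "\<bar>pd i (\<lambda>x. f x * g x) x\<bar> * r \<le> 4 * M * M'"
      "\<bar>pd i (pd j (\<lambda>x. f x * g x)) x\<bar> * r\<^sup>2 \<le> 4 * M * M'" for i j
    using 0 1[of i] 2[of i j] Ck_scalar_2D(1)[OF assms(1)] Ck_scalar_2D(1)[OF assms(2)]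
    by (simp_all add: pd_mult pd_pd_mult[OF assms(1,2)] power2_eq_square)
  then show ?thesis unfolding jet_bound_def by blast
qed

lemma jet_bound_exists:
  fixes f :: "real^'n \<Rightarrow> real"
  shows "\<exists>M. jet_bound r M f x"
proof -
  define M where "M = \<bar>f x\<bar> + (\<Sum>i\<in>UNIV. \<bar>pd i f x * r\<bar>) + (\<Sum>i\<in>UNIV. \<Sum>j\<in>UNIV. \<bar>pd i (pd j f) x * r\<^sup>2\<bar>)"
  have a: "(\<Sum>i\<in>UNIV. \<bar>pd i f x * r\<bar>) \<ge> 0" "(\<Sum>i\<in>UNIV. \<Sum>j\<in>UNIV. \<bar>pd i (pd j f) x * r\<^sup>2\<bar>) \<ge> 0"
    by (auto intro!: sum_nonneg)
  have b: "\<bar>pd i f x\<bar> * r \<le> (\<Sum>i\<in>UNIV. \<bar>pd i f x * r\<bar>)" for i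
    using member_le_sum[of i UNIV "\<lambda>i. \<bar>pd i f x * r\<bar>"] mult_left_mono[OF abs_ge_self[of r], of "\<bar>pd i f x\<bar>"]
    by (auto simp: abs_mult)
  have c: "\<bar>pd i (pd j f) x\<bar> * r\<^sup>2 \<le> (\<Sum>i\<in>UNIV. \<Sum>j\<in>UNIV. \<bar>pd i (pd j f) x * r\<^sup>2\<bar>)" for i j
    using member_le_sum[of j UNIV "\<lambda>j. \<bar>pd i (pd j f) x * r\<^sup>2\<bar>"]
      member_le_sum[of i UNIV "\<lambda>i. \<Sum>j\<in>UNIV. \<bar>pd i (pd j f) x * r\<^sup>2\<bar>"]
    by (auto simp: abs_mult sum_nonneg)
  have "\<bar>f x\<bar> \<le> M" "\<bar>pd i f x\<bar> * r \<le> M" "\<bar>pd i (pd j f) x\<bar> * r\<^sup>2 \<le> M" for i j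
    using a b[of i] c[of i j] abs_ge_zero[of "f x"] unfolding M_def by linarith+
  then show ?thesis unfolding jet_bound_def by blast
qed

text \<open>With \<open>M = 0\<close> the product bound is zero for every \<open>M'\<close>, so it
  suffices that some bound for \<open>g\<close> exists at the single point \<open>x\<close>. This
  serves for points where the two-jet of a cutoff vanishes.\<close>

lemma jet_bound_mult_0:
  fixes f :: "real^'n \<Rightarrow> real"
  assumes "Ck_scalar 2 f" "Ck_scalar 2 g" "jet_bound r 0 f x" "0 \<le> r"
  shows "jet_bound r 0 (\<lambda>x. f x * g x) x"
  using jet_bound_exists[of r g x] jet_bound_mult[OF assms(1,2,3) _ assms(4)] by auto

lemma jet_bound_minus:
  assumes "Ck_scalar 2 f" "jet_bound r M f x"
  shows "jet_bound r M (\<lambda>x. - f x) x"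
proof -
  have "pd j (\<lambda>x. - f x) = (\<lambda>x. - pd j f x)" for j
    using Ck_scalar_2D[OF assms(1)] by (auto simp: pd_minus)
  then show ?thesis using assms(2) Ck_scalar_2D[OF assms(1)] unfolding jet_bound_def by (simp add: pd_minus)
qed

lemma jet_bound_diff:
  assumes "Ck_scalar 2 f" "Ck_scalar 2 g" "jet_bound r M f x" "jet_bound r M' g x" "0 \<le> r"
  shows "jet_bound r (M + M') (\<lambda>x. f x - g x) x"
  using jet_bound_add[OF assms(1) Ck_scalar_minus[OF assms(2)] assms(3) jet_bound_minus[OF assms(2,4)] assms(5)]
  by simp

lemma jet_bound_sum:
  assumes "finite I" "\<And>p. p \<in> I \<Longrightarrow> Ck_scalar 2 (f p)" "\<And>p. p \<in> I \<Longrightarrow> jet_bound r (M p) (f p) x" "0 \<le> r"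
  shows "jet_bound r (\<Sum>p\<in>I. M p) (\<lambda>x. \<Sum>p\<in>I. f p x) x"
  using assms(1-3)
proof (induction I)
  case empty
  then show ?case by (simp add: jet_bound_const)
next
  case (insert p I)
  then show ?case using \<open>0 \<le> r\<close> by (auto intro!: jet_bound_add Ck_scalar_sum)
qed

text \<open>The mean value inequality; \<open>CARD('n) * B\<close> bounds the operator norm of the
  derivative because each coordinate of a vector is at most its norm.\<close>

lemma abs_diff_le_pd:
  fixes g :: "real^'n \<Rightarrow> real" and B :: real
  assumes "convex S" "\<And>z. z \<in> S \<Longrightarrow> g differentiable at z" "\<And>z j. z \<in> S \<Longrightarrow> \<bar>pd j g z\<bar> \<le> B"
    and "x \<in> S" "y \<in> S"
  shows "\<bar>g x - g y\<bar> \<le> CARD('n) * B * norm (x - y)"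
proof -
  have "norm (g x - g y) \<le> CARD('n) * B * norm (x - y)"
  proof (rule differentiable_bound[OF assms(1) _ _ assms(4,5)])
    show "(g has_derivative (\<lambda>h. \<Sum>j\<in>UNIV. h $ j * pd j g z)) (at z within S)" if "z \<in> S" for z
      using has_derivative_pd[OF assms(2)[OF that]] has_derivative_at_withinI by blast
    show "onorm (\<lambda>h. \<Sum>j\<in>UNIV. h $ j * pd j g z) \<le> CARD('n) * B" if "z \<in> S" for z
    proof (rule onorm_le)
      fix h :: "real^'n"
      have "norm (\<Sum>j\<in>UNIV. h $ j * pd j g z) \<le> (\<Sum>j\<in>(UNIV :: 'n set). norm h * B)"
        using assms(3)[OF that] component_le_norm_cart[of h]
        by (intro sum_norm_le) (auto simp: abs_mult intro!: mult_mono)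
      then show "norm (\<Sum>j\<in>UNIV. h $ j * pd j g z) \<le> CARD('n) * B * norm h"
        by (simp add: mult.commute mult.left_commute)
    qed
  qed
  then show ?thesis by simp
qed

text \<open>Integration from \<open>y\<close> inside \<open>cball y d\<close>: second derivatives
  are at most \<open>L * d\<close>, hence first derivatives at most
  \<open>2 * L * d\<^sup>2\<close>, hence values at most \<open>4 * L * d ^ 3\<close>. Each 2 is the
  dimension factor of \<open>abs_diff_le_pd\<close>.\<close>

lemma jet_bound_vanishing:
  fixes f :: "real^2 \<Rightarrow> real"
  assumes f: "Ck_scalar 2 f"
    and lip: "\<And>i j x z. \<bar>pd i (pd j f) x - pd i (pd j f) z\<bar> \<le> L * norm (x - z)"
    and y: "f y = 0" "\<And>i. pd i f y = 0" "\<And>i j. pd i (pd j f) y = 0"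
    and x: "norm (x - y) \<le> d" and L: "0 \<le> L"
  shows "jet_bound d (4 * L * d ^ 3) f x"
proof -
  have d: "0 \<le> d" using x norm_ge_zero order_trans by blast
  have 2: "\<bar>pd i (pd j f) z\<bar> \<le> L * d" if "z \<in> cball y d" for i j z
  proof -
    have "L * norm (z - y) \<le> L * d"
      using that L by (intro mult_left_mono) (auto simp: dist_norm norm_minus_commute)
    then show ?thesis using lip[of i j z y] y(3)[of i j] by linarith
  qed
  have 1: "\<bar>pd i f z\<bar> \<le> 2 * L * d\<^sup>2" if z: "z \<in> cball y d" for i z
  proof -
    have "\<bar>pd i f z - pd i f y\<bar> \<le> CARD(2) * (L * d) * norm (z - y)"
      by (rule abs_diff_le_pd[of "cball y d"]) (use z d 2 Ck_scalar_2D[OF f] in auto)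
    also have "\<dots> \<le> 2 * (L * d) * d"
      using L d z by (simp add: mult_left_mono dist_norm norm_minus_commute)
    finally show ?thesis using y by (simp add: power2_eq_square mult.assoc)
  qed
  have "\<bar>f x - f y\<bar> \<le> CARD(2) * (2 * L * d\<^sup>2) * norm (x - y)"
    by (rule abs_diff_le_pd[of "cball y d"])
       (use x d 1 Ck_scalar_2D[OF f] in \<open>auto simp: dist_norm norm_minus_commute\<close>)
  also have "\<dots> \<le> 2 * (2 * L * d\<^sup>2) * d"
    using L d x by (simp add: mult_left_mono)
  finally have 0: "\<bar>f x\<bar> \<le> 4 * L * d ^ 3" using y by (simp add: power2_eq_square power3_eq_cube ac_simps)
  have x': "x \<in> cball y d" using x by (simp add: dist_norm norm_minus_commute)
  have Ld: "L * d ^ 3 \<ge> 0" using L d by simp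
  have d1: "\<bar>pd i f x\<bar> * d \<le> 4 * L * d ^ 3" for i
    using mult_right_mono[OF 1[OF x', of i] d] Ld by (simp add: power2_eq_square power3_eq_cube ac_simps)
  have d2: "\<bar>pd i (pd j f) x\<bar> * d\<^sup>2 \<le> 4 * L * d ^ 3" for i j
    using mult_right_mono[OF 2[OF x', of i j] zero_le_power2[of d]] Ld by (simp add: power2_eq_square power3_eq_cube ac_simps)
  show ?thesis using 0 d1 d2 unfolding jet_bound_def by blast
qed

section \<open>Quasi-interpolation\<close>

lemma pd_eq_0_open:
  assumes "open S" "x \<in> S" "\<And>y. y \<in> S \<Longrightarrow> f y = 0"
  shows "pd j f x = 0"
  using pd_cong_open[OF assms(1,2), of f "\<lambda>x. 0"] assms(3) by (simp add: pd_const)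

lemma bounded_compact_support:
  fixes f :: "real^'n \<Rightarrow> real"
  assumes "continuous_on UNIV f" "\<And>x. norm x > R \<Longrightarrow> f x = 0"
  shows "\<exists>B\<ge>0. \<forall>x. \<bar>f x\<bar> \<le> B"
proof -
  have "compact (f ` cball 0 R)"
    using assms(1) by (intro compact_continuous_image) (auto intro: continuous_on_subset)
  then obtain B where B: "\<And>x. x \<in> cball 0 R \<Longrightarrow> \<bar>f x\<bar> \<le> B"
    using compact_imp_bounded[of "f ` cball 0 R"] unfolding bounded_iff ball_simps real_norm_def by blast
  have "\<bar>f x\<bar> \<le> max B 0" for x
    using B[of x] assms(2)[of x] by (cases "norm x > R") (auto simp: le_max_iff_disj)
  then show ?thesis by (intro exI[of _ "max B 0"]) auto
qed

lemma pd_eq_0_outside: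
  assumes "\<And>x. norm x > R \<Longrightarrow> f x = 0" "norm x > R"
  shows "pd j f x = 0"
proof (rule pd_eq_0_open)
  show "open {x. norm x > R}" by (intro open_Collect_less continuous_intros)
qed (use assms in auto)

lemma bump_jet_bound: "\<exists>B\<ge>0. \<forall>x. jet_bound 1 B bump x"
proof -
  have 1: "norm x > 2 \<Longrightarrow> pd i bump x = 0" for x i
    using pd_eq_0_outside[of 2 bump] bump_eq_0 by blast
  have 2: "norm x > 2 \<Longrightarrow> pd i (pd j bump) x = 0" for x i j
    using pd_eq_0_outside[of 2 "pd j bump"] 1 by blast
  note C = Ck_scalar_bump[of 2] Ck_scalar_2D[OF Ck_scalar_bump[of 2]]
  obtain B0 where B0: "B0 \<ge> 0" "\<And>x. \<bar>bump x\<bar> \<le> B0"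
    using bounded_compact_support[OF Ck_scalar_continuous[OF C(1)] bump_eq_0] by blast
  have "\<exists>B\<ge>0. \<forall>x. \<bar>pd i bump x\<bar> \<le> B" for i
    using bounded_compact_support[of "pd i bump" 2] 1
      Ck_scalar_bump[of "Suc 0"] by (simp add: Ck_scalar_Suc)
  then obtain B1 where B1: "\<And>i. B1 i \<ge> 0" "\<And>i x. \<bar>pd i bump x\<bar> \<le> B1 i" by metis
  have "\<exists>B\<ge>0. \<forall>x. \<bar>pd i (pd j bump) x\<bar> \<le> B" for i j
    using bounded_compact_support[of "pd i (pd j bump)" 2] 2 C(4) by blast
  then obtain B2 where B2: "\<And>i j. B2 i j \<ge> 0" "\<And>i j x. \<bar>pd i (pd j bump) x\<bar> \<le> B2 i j" by metis
  define B where "B = B0 + (B1 1 + B1 2) + (B2 1 1 + B2 1 2 + B2 2 1 + B2 2 2)"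
  have B: "B0 \<le> B" "\<forall>i. B1 i \<le> B" "\<forall>i j. B2 i j \<le> B"
    unfolding B_def forall_2 using B0(1) B1(1)[of 1] B1(1)[of 2] B2(1)[of 1 1] B2(1)[of 1 2] B2(1)[of 2 1] B2(1)[of 2 2]
    by auto
  then have "jet_bound 1 B bump x" for x
    unfolding jet_bound_def power_one mult_1_right using B0(2) B1(2) B2(2) by (meson order_trans)
  then show ?thesis using B0(1) B(1) by (intro exI[of _ B]) auto
qed

lemma cell_jet:
  assumes "r > 0"
  shows "pd i (cell r p) x = inverse r * pd i bump (inverse r *\<^sub>R x + - node p)"
    and "pd i (pd j (cell r p)) x = inverse r * inverse r * pd i (pd j bump) (inverse r *\<^sub>R x + - node p)"
proof -
  note d = Ck_scalar_2D[OF Ck_scalar_bump[of 2]]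
  have *: "pd i (cell r p) = (\<lambda>x. inverse r * pd i bump (inverse r *\<^sub>R x + - node p))" for i
    unfolding cell_def using pd_affine(2)[OF d(1), where a = "inverse r" and v = "- node p"] by fast
  then show "pd i (cell r p) x = inverse r * pd i bump (inverse r *\<^sub>R x + - node p)" by simp
  show "pd i (pd j (cell r p)) x = inverse r * inverse r * pd i (pd j bump) (inverse r *\<^sub>R x + - node p)"
    unfolding * using pd_mult[of "\<lambda>_. inverse r" x "\<lambda>x. pd j bump (inverse r *\<^sub>R x + - node p)" i]
      pd_affine[OF d(2), where a = "inverse r" and v = "- node p"]
    by (simp add: pd_const)
qed

text \<open>The weights of \<open>jet_bound\<close> absorb the factors 1/r of the chain rule, so one
  bound for \<open>bump\<close> serves all cells at all scales.\<close>

lemma cell_jet_bound_iff: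
  assumes "r > 0"
  shows "jet_bound r M (cell r p) x \<longleftrightarrow> jet_bound 1 M bump (inverse r *\<^sub>R x + - node p)"
  using assms unfolding jet_bound_def cell_jet[OF assms]
  by (simp add: cell_def abs_mult power2_eq_square field_simps)

lemma cell_jet_bound_0:
  assumes "r > 0" "norm (x - r *\<^sub>R node p) > 2 * r"
  shows "jet_bound r 0 (cell r p) x"
proof -
  have "inverse r *\<^sub>R x + - node p = inverse r *\<^sub>R (x - r *\<^sub>R node p)"
    using assms(1) by (simp add: algebra_simps)
  then have "norm (inverse r *\<^sub>R x + - node p) = norm (x - r *\<^sub>R node p) / r"
    using assms(1) by (simp only: norm_scaleR) (simp add: divide_inverse)
  then have "norm (inverse r *\<^sub>R x + - node p) > 2"
    using assms by (simp only: less_divide_eq) simp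
  moreover have "jet_bound 1 0 bump z" if "norm z > 2" for z
  proof -
    have "open {z::real^2. norm z > 2}" by (intro open_Collect_less continuous_intros)
    then show ?thesis
      using that jet_bound_cong_open[of "{z. norm z > 2}" z bump "\<lambda>_. 0"] bump_eq_0
      by (simp add: jet_bound_const)
  qed
  ultimately show ?thesis using cell_jet_bound_iff[OF assms(1)] by blast
qed

text \<open>At \<open>x\<close> at most 25 terms have a nonzero two-jet, and each contributes at
  most \<open>4 * M * B\<close> with \<open>B\<close> a bound for \<open>bump\<close>. The summand 1
  in the constant \<open>100 * B + 1\<close> ensures \<open>C \<ge> 1\<close>.\<close>

lemma sum_cell_jet_bound:
  "\<exists>C\<ge>1. \<forall>N r M F x. 0 < r \<longrightarrow> 0 \<le> M \<longrightarrow> (\<forall>p\<in>grid N. Ck_scalar 2 (F p)) \<longrightarrow>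
    (\<forall>p\<in>grid N. norm (x - r *\<^sub>R node p) \<le> 2 * r \<longrightarrow> jet_bound r M (F p) x) \<longrightarrow>
    jet_bound r (C * M) (\<lambda>x. \<Sum>p\<in>grid N. F p x * cell r p x) x"
proof -
  obtain B where B: "B \<ge> 0" "\<And>x. jet_bound 1 B bump x" using bump_jet_bound by blast
  have "jet_bound r ((100 * B + 1) * M) (\<lambda>x. \<Sum>p\<in>grid N. F p x * cell r p x) x"
    if r: "0 < r" and M: "0 \<le> M" and F: "\<And>p. p \<in> grid N \<Longrightarrow> Ck_scalar 2 (F p)"
      and FM: "\<And>p. p \<in> grid N \<Longrightarrow> norm (x - r *\<^sub>R node p) \<le> 2 * r \<Longrightarrow> jet_bound r M (F p) x"
    for N r M F x
  proof -
    let ?near = "\<lambda>p. norm (x - r *\<^sub>R node p) \<le> 2 * r"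
    have "jet_bound r (if ?near p then 4 * M * B else 0) (\<lambda>x. F p x * cell r p x) x" if "p \<in> grid N" for p
    proof (cases "?near p")
      case True
      then show ?thesis
        using jet_bound_mult[OF F Ck_scalar_cell FM] cell_jet_bound_iff[OF r] B(2) that r by simp
    next
      case False
      then have "jet_bound r 0 (\<lambda>x. cell r p x * F p x) x"
        using r that by (intro jet_bound_mult_0 Ck_scalar_cell F cell_jet_bound_0) auto
      then show ?thesis using False by (simp add: mult.commute)
    qed
    then have "jet_bound r (\<Sum>p\<in>grid N. if ?near p then 4 * M * B else 0) (\<lambda>x. \<Sum>p\<in>grid N. F p x * cell r p x) x"
      using r F by (intro jet_bound_sum Ck_scalar_mult Ck_scalar_cell) auto
    moreover have "(\<Sum>p\<in>grid N. if ?near p then 4 * M * B else 0) \<le> (100 * B + 1) * M"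
    proof -
      have "(\<Sum>p\<in>grid N. if ?near p then 4 * M * B else 0) = card {p\<in>grid N. ?near p} * (4 * M * B)"
        by (simp add: sum.If_cases Int_def)
      also have "\<dots> \<le> 25 * (4 * M * B)"
        using card_near_nodes[OF r, of N x] M B(1) by (intro mult_right_mono) auto
      finally show ?thesis using M by (simp add: algebra_simps)
    qed
    ultimately show ?thesis using jet_bound_mono by blast
  qed
  then show ?thesis using B(1) by (intro exI[of _ "100 * B + 1"]) auto
qed

text \<open>Only point values of \<open>f\<close> at the nodes enter, so the result is smooth for an
  arbitrary \<open>f\<close>.\<close>

definition interp :: "nat \<Rightarrow> real \<Rightarrow> (real^2 \<Rightarrow> real) \<Rightarrow> real^2 \<Rightarrow> real" where
  "interp N r f x = (\<Sum>p\<in>grid N. f (r *\<^sub>R node p) * cell r p x)"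

lemma Ck_scalar_interp: "Ck_scalar k (interp N r f)"
  unfolding interp_def by (intro Ck_scalar_sum Ck_scalar_mult Ck_scalar_const Ck_scalar_cell)

lemma interp_jet_bound:
  "\<exists>C\<ge>1. \<forall>N r f x M. 0 < r \<longrightarrow> 0 \<le> M \<longrightarrow>
    (\<forall>z. norm (x - z) \<le> 2 * r \<longrightarrow> \<bar>f z\<bar> \<le> M) \<longrightarrow> jet_bound r (C * M) (interp N r f) x"
proof -
  obtain C where "C \<ge> 1" and C: "\<forall>N r M F x. 0 < r \<longrightarrow> 0 \<le> M \<longrightarrow> (\<forall>p\<in>grid N. Ck_scalar 2 (F p)) \<longrightarrow>
    (\<forall>p\<in>grid N. norm (x - r *\<^sub>R node p) \<le> 2 * r \<longrightarrow> jet_bound r M (F p) x) \<longrightarrow>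
    jet_bound r (C * M) (\<lambda>x. \<Sum>p\<in>grid N. F p x * cell r p x) x"
    using sum_cell_jet_bound by blast
  have "jet_bound r (C * M) (interp N r f) x"
    if "0 < r" "0 \<le> M" "\<And>z. norm (x - z) \<le> 2 * r \<Longrightarrow> \<bar>f z\<bar> \<le> M" for N r f x M
    unfolding interp_def using that by (intro C[rule_format] jet_bound_const Ck_scalar_const) auto
  then show ?thesis using \<open>C \<ge> 1\<close> by (intro exI[of _ C]) auto
qed

text \<open>Interpolation reproduces constants where the cells sum to one. The strict inequality
  describes an open set, so the agreement there extends to the derivatives.\<close>

lemma interp_shift_jet_bound_iff:
  assumes "0 < r" and x: "\<And>i. \<bar>x $ i\<bar> < N * r"
  shows "jet_bound r M (\<lambda>x. interp N r f x - c) x \<longleftrightarrow> jet_bound r M (interp N r (\<lambda>z. f z - c)) x"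
proof (rule jet_bound_cong_open)
  have "{x::real^2. \<forall>i. \<bar>x $ i\<bar> < N * r} = {x. \<bar>x $ 1\<bar> < N * r} \<inter> {x. \<bar>x $ 2\<bar> < N * r}"
    by (auto simp: forall_2)
  then show "open {x::real^2. \<forall>i. \<bar>x $ i\<bar> < N * r}"
    by (auto intro!: open_Int open_Collect_less continuous_intros)
  show "x \<in> {x. \<forall>i. \<bar>x $ i\<bar> < N * r}" using x by auto
  fix y :: "real^2" assume "y \<in> {x. \<forall>i. \<bar>x $ i\<bar> < N * r}"
  then have "(\<Sum>p\<in>grid N. cell r p y) = 1" using assms(1) by (intro sum_cell_eq_1) (auto intro: less_imp_le)
  then show "interp N r f y - c = interp N r (\<lambda>z. f z - c) y"
    by (simp add: interp_def left_diff_distrib sum_subtractf flip: sum_distrib_left)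
qed

section \<open>Collapsing the critical values\<close>

text \<open>Let \<open>U\<close> be the union of the open intervals of radius
  \<open>2 * \<rho>\<close> about \<open>S\<close>, and let \<open>h\<close> increase from
  \<open>s\<close> to \<open>t\<close> by the length of the part of (s, t] outside \<open>U\<close>.
  Then \<open>h\<close> has slope at most 1, is constant on each interval, and departs from the
  identity by at most the length of \<open>U\<close>.\<close>

lemma ex_collapse:
  fixes S :: "real set" and \<rho> :: real
  assumes S: "finite S" and \<rho>: "\<rho> > 0"
  shows "\<exists>h. h 0 = 0 \<and> (\<forall>s t. \<bar>h s - h t\<bar> \<le> \<bar>s - t\<bar>) \<and> (\<forall>t. \<bar>h t - t\<bar> \<le> card S * (4 * \<rho>)) \<and>
    (\<forall>c\<in>S. \<forall>s t. \<bar>s - c\<bar> < 2 * \<rho> \<and> \<bar>t - c\<bar> < 2 * \<rho> \<longrightarrow> h s = h t)"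
proof -
  define U where "U = (\<Union>c\<in>S. {c - 2 * \<rho><..<c + 2 * \<rho>})"
  define g where "g t = measure lborel (U \<inter> {..t})" for t
  define h where "h t = t - g t + g 0" for t
  have int: "{a<..<b} \<in> fmeasurable lborel" "{a<..b} \<in> fmeasurable lborel" for a b :: real
    by (cases "a \<le> b"; auto intro!: fmeasurableI)+
  have U: "U \<in> fmeasurable lborel"
    unfolding U_def using S int by (intro fmeasurable.finite_UN) auto
  have Ut: "U \<inter> {..t} \<in> fmeasurable lborel" for t
    using U by (intro fmeasurable_Int_fmeasurable) auto
  have "measure lborel U \<le> (\<Sum>c\<in>S. measure lborel {c - 2 * \<rho><..<c + 2 * \<rho>})"
    unfolding U_def using S int by (intro measure_UNION_le) auto
  also have "\<dots> = card S * (4 * \<rho>)"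
    using \<rho> by (simp add: measure_lborel_Ioo)
  finally have mU: "measure lborel U \<le> card S * (4 * \<rho>)" .
  have g: "0 \<le> g t" "g t \<le> card S * (4 * \<rho>)" for t
    using measure_mono_fmeasurable[of "U \<inter> {..t}" U lborel] U Ut[of t] mU
    by (auto simp: g_def fmeasurableD)
  have diff: "g t - g s = measure lborel (U \<inter> {s<..t})" if "s \<le> t" for s t
  proof -
    have *: "U \<inter> {..t} = U \<inter> {..s} \<union> U \<inter> {..t}" "U \<inter> {..t} - U \<inter> {..s} = U \<inter> {s<..t}"
      using that by auto
    have "measure lborel (U \<inter> {..s} \<union> U \<inter> {..t}) = g s + measure lborel (U \<inter> {..t} - U \<inter> {..s})"
      unfolding g_def by (rule measure_Un2[OF Ut Ut])
    then show ?thesis using * by (simp add: g_def)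
  qed
  have lip: "0 \<le> h t - h s \<and> h t - h s \<le> t - s" if "s \<le> t" for s t
  proof -
    have "measure lborel (U \<inter> {s<..t}) \<le> measure lborel {s<..t}"
      using U int by (intro measure_mono_fmeasurable) (auto simp: fmeasurableD)
    then have "g t - g s \<le> t - s" "0 \<le> g t - g s" using diff[OF that] that by simp_all
    then show ?thesis by (simp add: h_def)
  qed
  have const: "h s = h t" if "{s<..t} \<subseteq> U" "s \<le> t" for s t
  proof -
    have "U \<inter> {s<..t} = {s<..t}" using that by auto
    then show ?thesis using diff[OF that(2)] that(2) by (simp add: h_def)
  qed
  have "\<bar>h s - h t\<bar> \<le> \<bar>s - t\<bar>" for s t
    using lip[of s t] lip[of t s] by (cases "s \<le> t") auto
  moreover have "\<bar>h t - t\<bar> \<le> card S * (4 * \<rho>)" for t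
    using g[of t] g[of 0] by (auto simp: h_def abs_le_iff)
  moreover have "h s = h t" if "c \<in> S" "\<bar>s - c\<bar> < 2 * \<rho>" "\<bar>t - c\<bar> < 2 * \<rho>" for c s t
  proof -
    have sub: "{a<..b} \<subseteq> U" if "\<bar>a - c\<bar> < 2 * \<rho>" "\<bar>b - c\<bar> < 2 * \<rho>" for a b
    proof -
      have "{a<..b} \<subseteq> {c - 2 * \<rho><..<c + 2 * \<rho>}" using that by auto
      also have "\<dots> \<subseteq> U" using \<open>c \<in> S\<close> unfolding U_def by blast
      finally show ?thesis .
    qed
    show ?thesis
    proof (cases "s \<le> t")
      case True
      then show ?thesis by (rule const[OF sub[OF that(2,3)]])
    next
      case False
      then have "t \<le> s" by simp
      then show ?thesis by (rule const[OF sub[OF that(3,2)], symmetric])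
    qed
  qed
  ultimately show ?thesis by (intro exI[of _ h]) (auto simp: h_def)
qed

text \<open>About \<open>s\<^sup>-\<^sup>2\<close> squares of side \<open>s\<close> meet \<open>K\<close>, and each has an image of diameter \<open>O(s\<^sup>3)\<close>.\<close>

lemma ex_image_cover:
  fixes \<psi> :: "real^2 \<Rightarrow> real" and A R \<delta> :: real
  assumes K: "\<And>y. y \<in> K \<Longrightarrow> norm y \<le> R" and cubic: "\<And>y z. y \<in> K \<Longrightarrow> z \<in> K \<Longrightarrow> \<bar>\<psi> y - \<psi> z\<bar> \<le> A * norm (y - z) ^ 3"
    and "0 \<le> A" "0 \<le> R" "0 < \<delta>"
  shows "\<exists>S \<rho>::real. finite S \<and> 0 < \<rho> \<and> card S * (4 * \<rho>) \<le> \<delta> \<and> (\<forall>y\<in>K. \<exists>c\<in>S. \<bar>\<psi> y - c\<bar> \<le> \<rho>)"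
proof -
  \<comment> \<open>The node count is at most ((2R + 5) / s)^2, and \<open>\<rho>\<close> is (64A +
    1) s^3. So \<open>card S * (4 * \<rho>)\<close> is at most \<open>D * s\<close>, and
    \<open>s\<close> is chosen to make this at most \<open>\<delta>\<close>.\<close>
  define D where "D = (2 * R + 5)\<^sup>2 * (4 * (64 * A + 1))"
  have D: "D > 0" using assms by (auto simp: D_def intro!: mult_pos_pos zero_less_power)
  define s where "s = min 1 (\<delta> / D)"
  have s: "0 < s" "s \<le> 1" "D * s \<le> \<delta>"
    using D \<open>0 < \<delta>\<close> by (auto simp: s_def min_def field_simps)
  \<comment> \<open>Two points within \<open>2 * s\<close> of the same node are at distance at most
    \<open>4 * s\<close>, and 64 is the cube of 4. The added 1 keeps \<open>\<rho>\<close> positive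
    when \<open>A = 0\<close>.\<close>
  define \<rho> where "\<rho> = (64 * A + 1) * s ^ 3"
  \<comment> \<open>The extra 1 accommodates the floor of a negative coordinate, which may be as low
    as -R/s - 1.\<close>
  define N where "N = nat \<lceil>R / s\<rceil> + 1"
  have N: "R / s + 1 \<le> N" "N \<le> R / s + 2"
  proof -
    have "0 \<le> R / s" using \<open>0 \<le> R\<close> s by simp
    then have "real N = of_int \<lceil>R / s\<rceil> + 1" by (simp add: N_def)
    then show "R / s + 1 \<le> N" "N \<le> R / s + 2"
      using le_of_int_ceiling[of "R / s"] of_int_ceiling_le_add_one[of "R / s"] by linarith+
  qed
  \<comment> \<open>For a node with no point of \<open>K\<close> nearby the choice is arbitrary;
    such values merely enlarge \<open>S\<close> within the bound on its size.\<close>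
  define Y where "Y p = (SOME y. y \<in> K \<and> norm (y - s *\<^sub>R node p) \<le> 2 * s)" for p
  define S where "S = (\<lambda>p. \<psi> (Y p)) ` grid N"
  have "card S \<le> (2 * N + 1)\<^sup>2"
    unfolding S_def card_grid[symmetric] by (rule card_image_le) simp
  then have "real (card S) \<le> (2 * real N + 1)\<^sup>2"
    using of_nat_mono[of "card S" "(2 * N + 1)\<^sup>2", where 'a = real] by (simp add: add.commute)
  also have "\<dots> \<le> ((2 * R + 5) / s)\<^sup>2"
  proof (rule power_mono)
    have "2 * real N + 1 \<le> 2 * (R / s) + 5 * 1" using N(2) by simp
    also have "\<dots> \<le> 2 * (R / s) + 5 * (1 / s)" using s by (intro add_left_mono mult_left_mono) auto
    finally show "2 * real N + 1 \<le> (2 * R + 5) / s" by (simp add: add_divide_distrib)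
  qed simp
  finally have "real (card S) * (4 * \<rho>) \<le> ((2 * R + 5) / s)\<^sup>2 * (4 * \<rho>)"
    using s \<open>0 \<le> A\<close> by (intro mult_right_mono) (auto simp: \<rho>_def)
  also have "\<dots> = D * s"
    using s by (simp add: D_def \<rho>_def power2_eq_square power3_eq_cube)
  finally have "real (card S) * (4 * \<rho>) \<le> \<delta>" using s by simp
  moreover have "\<exists>c\<in>S. \<bar>\<psi> y - c\<bar> \<le> \<rho>" if y: "y \<in> K" for y
  proof -
    define p where "p = (\<lfloor>y $ 1 / s\<rfloor>, \<lfloor>y $ 2 / s\<rfloor>)"
    have fl: "\<bar>y $ i - s * of_int \<lfloor>y $ i / s\<rfloor>\<bar> \<le> s" "\<bar>real_of_int \<lfloor>y $ i / s\<rfloor>\<bar> \<le> N" for i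
    proof -
      have 1: "of_int \<lfloor>y $ i / s\<rfloor> \<le> y $ i / s" "y $ i / s \<le> of_int \<lfloor>y $ i / s\<rfloor> + 1" by linarith+
      then have "of_int \<lfloor>y $ i / s\<rfloor> * s \<le> y $ i" "y $ i \<le> (of_int \<lfloor>y $ i / s\<rfloor> + 1) * s"
        using s(1) by (simp_all only: pos_le_divide_eq pos_divide_le_eq)
      then show "\<bar>y $ i - s * of_int \<lfloor>y $ i / s\<rfloor>\<bar> \<le> s"
        using s(1) by (simp only: abs_le_iff algebra_simps) linarith
      have "\<bar>y $ i\<bar> \<le> R" using K[OF y] component_le_norm_cart[of y i] by linarith
      then have "\<bar>y $ i / s\<bar> \<le> R / s" using s(1) by (simp add: divide_right_mono)
      then show "\<bar>real_of_int \<lfloor>y $ i / s\<rfloor>\<bar> \<le> N" using 1 N(1) by linarith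
    qed
    have p: "p \<in> grid N"
      using fl(2)[of 1] fl(2)[of 2] by (auto simp: p_def grid_def abs_le_iff)
    have "norm (y - s *\<^sub>R node p) \<le> 2 * s"
      using norm_le_2[of "y - s *\<^sub>R node p"] fl(1)[of 1] fl(1)[of 2] by (simp add: p_def node_def)
    moreover from this y have Y: "Y p \<in> K" "norm (Y p - s *\<^sub>R node p) \<le> 2 * s"
      unfolding Y_def by (metis (mono_tags, lifting) someI_ex)+
    ultimately have "norm (y - Y p) \<le> 4 * s"
      using norm_triangle_ineq4[of "y - s *\<^sub>R node p" "Y p - s *\<^sub>R node p"] by simp
    then have "A * norm (y - Y p) ^ 3 \<le> A * (4 * s) ^ 3"
      using \<open>0 \<le> A\<close> by (intro mult_left_mono power_mono) auto
    moreover have "A * (4 * s) ^ 3 \<le> \<rho>" using s by (simp add: \<rho>_def power_mult_distrib algebra_simps)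
    ultimately have "\<bar>\<psi> y - \<psi> (Y p)\<bar> \<le> \<rho>" using cubic[OF y Y(1)] by linarith
    then show ?thesis using p by (auto simp: S_def)
  qed
  moreover have "finite S" "0 < \<rho>" using s \<open>0 \<le> A\<close> by (auto simp: S_def \<rho>_def)
  ultimately show ?thesis by (intro exI[of _ S] exI[of _ \<rho>] conjI ballI) simp_all
qed

section \<open>Quadratic Taylor polynomials\<close>

text \<open>With the coefficients as parameters the family is closed under \<open>pd\<close>:
  differentiation only shifts coefficients.\<close>

definition quad :: "real \<Rightarrow> real \<Rightarrow> real \<Rightarrow> real \<Rightarrow> real \<Rightarrow> real \<Rightarrow> real^2 \<Rightarrow> real^2 \<Rightarrow> real" where
  "quad c p q a b d y x = c + p * (x $ 1 - y $ 1) + q * (x $ 2 - y $ 2) + a / 2 * (x $ 1 - y $ 1) * (x $ 1 - y $ 1)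
     + b * (x $ 1 - y $ 1) * (x $ 2 - y $ 2) + d / 2 * (x $ 2 - y $ 2) * (x $ 2 - y $ 2)"

lemma Ck_scalar_quad: "Ck_scalar k (quad c p q a b d y)"
  unfolding quad_def
  by (intro Ck_scalar_add Ck_scalar_mult Ck_scalar_diff Ck_scalar_const Ck_scalar_nth)

lemma pd_quad:
  "pd 1 (quad c p q a b d y) = quad p a b 0 0 0 y" "pd 2 (quad c p q a b d y) = quad q b d 0 0 0 y"
proof -
  have nth: "((\<lambda>x::real^2. x $ i) has_derivative (\<lambda>h. h $ i)) (at x)" for i x
    by (intro bounded_linear_imp_has_derivative bounded_linear_vec_nth)
  have *: "(quad c p q a b d y has_derivative (\<lambda>h. h $ 1 * quad p a b 0 0 0 y x + h $ 2 * quad q b d 0 0 0 y x)) (at x)" for x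
    unfolding quad_def by (rule derivative_eq_intros nth refl)+ (auto simp: fun_eq_iff field_simps)
  show "pd 1 (quad c p q a b d y) = quad p a b 0 0 0 y" "pd 2 (quad c p q a b d y) = quad q b d 0 0 0 y"
    using pd_eqI[OF *] by (auto simp: axis_def)
qed

definition taylor2 :: "(real^2 \<Rightarrow> real) \<Rightarrow> real^2 \<Rightarrow> real^2 \<Rightarrow> real" where
  "taylor2 f y = quad (f y) (pd 1 f y) (pd 2 f y) (pd 1 (pd 1 f) y) (pd 1 (pd 2 f) y) (pd 2 (pd 2 f) y) y"

text \<open>The remainder has zero two-jet at \<open>y\<close>, and its second derivatives have the
  Lipschitz constant \<open>L\<close> of those of \<open>f\<close>, since those of a quadratic are
  constant. So \<open>jet_bound_vanishing\<close> applies.\<close>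

lemma taylor2_jet_bound:
  assumes f: "Ck_scalar 2 f"
    and lip: "\<And>i j x z. \<bar>pd i (pd j f) x - pd i (pd j f) z\<bar> \<le> L * norm (x - z)" and "0 \<le> L"
    and x: "norm (x - y) \<le> d"
  shows "jet_bound d (4 * L * d ^ 3) (\<lambda>x. f x - taylor2 f y x) x"
proof -
  have q: "Ck_scalar 2 (taylor2 f y)" by (simp add: taylor2_def Ck_scalar_quad)
  note D = Ck_scalar_2D[OF f] Ck_scalar_2D[OF q]
  \<comment> \<open>The polynomial has a single mixed coefficient, which must match both mixed
    derivatives of \<open>f\<close>.\<close>
  have sym: "pd 2 (pd 1 f) y = pd 1 (pd 2 f) y" by (rule pd_commute[OF f])
  have q1: "pd i (taylor2 f y) y = pd i f y" for i
  proof -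
    have "\<forall>i. pd i (taylor2 f y) y = pd i f y" unfolding forall_2 by (simp add: taylor2_def pd_quad) (simp add: quad_def)
    then show ?thesis by blast
  qed
  have q2: "pd i (pd j (taylor2 f y)) x = pd i (pd j f) y" for i j x
  proof -
    have "\<forall>i j. pd i (pd j (taylor2 f y)) x = pd i (pd j f) y"
      unfolding forall_2 using sym by (simp add: taylor2_def pd_quad) (simp add: quad_def)
    then show ?thesis by blast
  qed
  have e1: "pd i (\<lambda>x. f x - taylor2 f y x) = (\<lambda>x. pd i f x - pd i (taylor2 f y) x)" for i
    by (rule ext) (simp add: pd_diff D)
  have e2: "pd i (pd j (\<lambda>x. f x - taylor2 f y x)) x = pd i (pd j f) x - pd i (pd j f) y" for i j x
    unfolding e1 by (simp add: pd_diff D q2)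
  have e3: "pd i (\<lambda>x. f x - taylor2 f y x) y = 0" for i
    by (simp add: e1 q1)
  show ?thesis
  proof (rule jet_bound_vanishing[of _ L y])
    show "Ck_scalar 2 (\<lambda>x. f x - taylor2 f y x)" using f q by (rule Ck_scalar_diff)
    show "f y - taylor2 f y y = 0" by (simp add: taylor2_def quad_def)
  qed (use assms in \<open>simp_all add: e2 e3\<close>)
qed

section \<open>Approximating the stream function\<close>

text \<open>Blending the Taylor polynomials at the nodes with the cells gives \<open>T\<close>. As
  the cells sum to one where \<open>f\<close> lives, \<open>f - T\<close> is a sum of Taylor
  remainders times cells, each remainder being of size 4 L (2r)^3 = 32 L r^3 near its node.\<close>

lemma ex_smooth_approx_taylor:
  "\<exists>C\<ge>1. \<forall>(f::real^2 \<Rightarrow> real) L R r. Ck_scalar 2 f \<longrightarrow> 0 \<le> L \<longrightarrow>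
    (\<forall>i j x z. \<bar>pd i (pd j f) x - pd i (pd j f) z\<bar> \<le> L * norm (x - z)) \<longrightarrow>
    (\<forall>x. norm x > R \<longrightarrow> f x = 0) \<longrightarrow> 0 < r \<longrightarrow>
    (\<exists>T. (\<forall>k. Ck_scalar k T) \<and> (\<forall>x. norm x > R + 2 * r \<longrightarrow> T x = 0) \<and>
      (\<forall>x. jet_bound r (C * L * r ^ 3) (\<lambda>x. T x - f x) x))"
proof -
  obtain C where C: "C \<ge> 1" "\<forall>N r M F x. 0 < r \<longrightarrow> 0 \<le> M \<longrightarrow> (\<forall>p\<in>grid N. Ck_scalar 2 (F p)) \<longrightarrow>
    (\<forall>p\<in>grid N. norm (x - r *\<^sub>R node p) \<le> 2 * r \<longrightarrow> jet_bound r M (F p) x) \<longrightarrow>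
    jet_bound r (C * M) (\<lambda>x. \<Sum>p\<in>grid N. F p x * cell r p x) x"
    using sum_cell_jet_bound by blast
  have "\<exists>T. (\<forall>k. Ck_scalar k T) \<and> (\<forall>x. norm x > R + 2 * r \<longrightarrow> T x = 0) \<and>
      (\<forall>x. jet_bound r (32 * C * L * r ^ 3) (\<lambda>x. T x - f x) x)"
    if f: "Ck_scalar 2 f" and L: "0 \<le> L"
      and lip: "\<And>i j x z. \<bar>pd i (pd j f) x - pd i (pd j f) z\<bar> \<le> L * norm (x - z)"
      and R: "\<And>x. norm x > R \<Longrightarrow> f x = 0" and r: "0 < r" for f :: "real^2 \<Rightarrow> real" and L R r
  proof -
    define N where "N = nat \<lceil>R / r\<rceil>"
    define T where "T x = (\<Sum>p\<in>grid N. taylor2 f (r *\<^sub>R node p) x * cell r p x)" for x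
    have smooth: "Ck_scalar k (taylor2 f y)" for k y
      by (simp add: taylor2_def Ck_scalar_quad)
    have T: "Ck_scalar k T" for k
      unfolding T_def by (intro Ck_scalar_sum Ck_scalar_mult smooth Ck_scalar_cell)
    have supp: "T x = 0" if x: "norm x > R + 2 * r" for x
    proof -
      \<comment> \<open>A node within \<open>2 * r\<close> of \<open>x\<close> lies outside the ball
        of radius \<open>R\<close>, where the two-jet of \<open>f\<close> is zero; any other cell
        vanishes at \<open>x\<close>.\<close>
      have "taylor2 f (r *\<^sub>R node p) x * cell r p x = 0" for p
      proof (cases "norm (x - r *\<^sub>R node p) \<le> 2 * r")
        case True
        then have y: "norm (r *\<^sub>R node p) > R"
          using x norm_triangle_ineq2[of x "r *\<^sub>R node p"] by linarith
        have 1: "norm x > R \<Longrightarrow> pd i f x = 0" for i x using pd_eq_0_outside[of R f] R by blast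
        have 2: "norm x > R \<Longrightarrow> pd i (pd j f) x = 0" for i j x
          using pd_eq_0_outside[of R "pd j f"] 1 by blast
        show ?thesis using y by (simp add: taylor2_def quad_def R 1 2)
      next
        case False
        then show ?thesis using cell_jet_bound_0[OF r, of x p] by (simp add: jet_bound_def)
      qed
      then show ?thesis by (simp only: T_def sum.neutral_const)
    qed
    have eq: "f x - T x = (\<Sum>p\<in>grid N. (f x - taylor2 f (r *\<^sub>R node p) x) * cell r p x)" for x
    proof -
      \<comment> \<open>The identity is global: the grid covers the ball of radius \<open>R\<close>,
        and outside it both sides are 0.\<close>
      have "f x = f x * (\<Sum>p\<in>grid N. cell r p x)"
      proof (cases "norm x > R")
        case False
        have "R / r \<le> N" unfolding N_def by (rule of_nat_ceiling)
        then have "R \<le> N * r" using r by (simp add: pos_divide_le_eq)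
        then have "\<bar>x $ i\<bar> \<le> N * r" for i
          using False component_le_norm_cart[of x i] by linarith
        then show ?thesis using sum_cell_eq_1[OF r] by simp
      qed (simp add: R)
      then show ?thesis
        unfolding T_def left_diff_distrib sum_subtractf sum_distrib_left[symmetric] by simp
    qed
    have "jet_bound r (32 * C * L * r ^ 3) (\<lambda>x. T x - f x) x" for x
    proof -
      have "jet_bound r (C * (32 * L * r ^ 3)) (\<lambda>x. \<Sum>p\<in>grid N. (f x - taylor2 f (r *\<^sub>R node p) x) * cell r p x) x"
      proof (rule C(2)[rule_format])
        fix p assume "norm (x - r *\<^sub>R node p) \<le> 2 * r"
        from taylor2_jet_bound[OF f lip L this]
        have "jet_bound (2 * r) (32 * L * r ^ 3) (\<lambda>x. f x - taylor2 f (r *\<^sub>R node p) x) x"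
          by (simp add: power_mult_distrib mult.assoc)
        then show "jet_bound r (32 * L * r ^ 3) (\<lambda>x. f x - taylor2 f (r *\<^sub>R node p) x) x"
          using r by (elim jet_bound_scale) auto
      qed (use r L f smooth in \<open>auto intro: Ck_scalar_diff\<close>)
      then have "jet_bound r (32 * C * L * r ^ 3) (\<lambda>x. f x - T x) x"
        unfolding eq by (simp add: ac_simps)
      from jet_bound_minus[OF Ck_scalar_diff[OF f T] this] show ?thesis by simp
    qed
    then show ?thesis using T supp by blast
  qed
  then show ?thesis using C(1) by (intro exI[of _ "32 * C"]) (auto simp: mult.assoc)
qed

lemma sum_half_powers_le: "r \<ge> 0 \<Longrightarrow> (\<Sum>k<n. r / 2 ^ Suc k) \<le> (r::real)"
proof -
  assume "r \<ge> 0"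
  have "(\<Sum>k<n. r / 2 ^ Suc k) = r - r / 2 ^ n"
    by (induction n) (auto simp: field_simps)
  then show ?thesis using \<open>r \<ge> 0\<close> by simp
qed

lemma ex_locally_constant_approx:
  fixes \<psi> :: "real^2 \<Rightarrow> real"
  assumes \<psi>: "Ck_scalar 2 \<psi>" and L: "0 \<le> L"
    and lip: "\<And>i j x z. \<bar>pd i (pd j \<psi>) x - pd i (pd j \<psi>) z\<bar> \<le> L * norm (x - z)"
    and supp: "\<And>x. norm x > R \<Longrightarrow> \<psi> x = 0"
    and K: "\<And>y. y \<in> K \<Longrightarrow> norm y \<le> R" and R: "0 \<le> R"
    and pd1: "\<And>y i. y \<in> K \<Longrightarrow> pd i \<psi> y = 0"
    and pd2: "\<And>y i j. y \<in> K \<Longrightarrow> pd i (pd j \<psi>) y = 0"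
    and \<epsilon>: "0 < \<epsilon>"
  shows "\<exists>\<Psi> e. (\<forall>k. Ck_scalar k \<Psi>) \<and> (\<forall>x. norm x > R + 10 \<longrightarrow> \<Psi> x = 0) \<and>
    0 < e \<and> (\<forall>x y i. y \<in> K \<longrightarrow> norm (x - y) < e \<longrightarrow> pd i \<Psi> x = 0) \<and>
    (\<forall>x. jet_bound 1 \<epsilon> (\<lambda>x. \<Psi> x - \<psi> x) x)"
proof -
  obtain C1 where C1: "C1 \<ge> 1" "\<forall>(f::real^2 \<Rightarrow> real) L R r. Ck_scalar 2 f \<longrightarrow> 0 \<le> L \<longrightarrow>
    (\<forall>i j x z. \<bar>pd i (pd j f) x - pd i (pd j f) z\<bar> \<le> L * norm (x - z)) \<longrightarrow>
    (\<forall>x. norm x > R \<longrightarrow> f x = 0) \<longrightarrow> 0 < r \<longrightarrow>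
    (\<exists>T. (\<forall>k. Ck_scalar k T) \<and> (\<forall>x. norm x > R + 2 * r \<longrightarrow> T x = 0) \<and>
      (\<forall>x. jet_bound r (C1 * L * r ^ 3) (\<lambda>x. T x - f x) x))"
    using ex_smooth_approx_taylor by blast
  obtain C2 where C2: "C2 \<ge> 1" "\<forall>N r f x M. 0 < r \<longrightarrow> 0 \<le> M \<longrightarrow>
    (\<forall>z. norm (x - z) \<le> 2 * r \<longrightarrow> \<bar>f z\<bar> \<le> M) \<longrightarrow> jet_bound r (C2 * M) (interp N r f) x"
    using interp_jet_bound by blast
  \<comment> \<open>2916 is 4 times the cube of 9, for the cubic estimate at distance nine mesh
    sizes from \<open>K\<close>. \<open>D0\<close> bounds the transition from \<open>T\<close> to
    \<open>E 0\<close>, \<open>D1\<close> the transition between consecutive scales, and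
    \<open>D * r0\<close> the total error. The leading 4 in \<open>D0\<close> and the 8 = 4 * 2 in
    \<open>D1\<close> come from \<open>jet_bound_mult\<close>, the 2 from a difference of two
    interpolants.\<close>
  define B where "B = 2916 * L"
  define D0 where "D0 = 4 * C2 * (C2 * B + B + C1 * L + 1)"
  define D1 where "D1 = 8 * C2 * C2 * B"
  define D where "D = C1 * L + D0 + D1"
  have nn: "0 \<le> B" "0 \<le> D0" "0 \<le> D1" "0 \<le> D"
    using L C1(1) C2(1) by (auto simp: B_def D0_def D1_def D_def intro!: mult_nonneg_nonneg add_nonneg_nonneg)
  define r0 where "r0 = min 1 (\<epsilon> / (D + 1))"
  have r0: "0 < r0" "r0 \<le> 1" using \<epsilon> nn by (auto simp: r0_def)
  have "D * r0 \<le> (D + 1) * (\<epsilon> / (D + 1))" using nn r0 by (intro mult_mono) (auto simp: r0_def)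
  then have r0D: "D * r0 \<le> \<epsilon>" using nn by simp
  define r where "r k = r0 / 2 ^ k" for k :: nat
  have r: "0 < r k" "r k \<le> r0" "r k \<le> 1" "r (Suc k) = r k / 2" for k
  proof -
    show "0 < r k" using r0 by (simp add: r_def)
    have "r0 * 1 \<le> r0 * 2 ^ k" using r0 by (intro mult_left_mono) auto
    then show "r k \<le> r0" by (simp add: r_def divide_le_eq)
    with r0 show "r k \<le> 1" by simp
  qed (simp add: r_def)
  have r_mono: "r l \<le> r k" if "k \<le> l" for k l
    using that r0 by (simp add: r_def frac_le power_increasing)

  \<comment> \<open>Cubic oscillation near \<open>K\<close> and the collapsed function
    \<open>H\<close>\<close>
  have near: "jet_bound d (4 * L * d ^ 3) (\<lambda>x. \<psi> x - \<psi> y) x" if "y \<in> K" "norm (x - y) \<le> d" for x y d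
  proof -
    have e1: "pd i (\<lambda>x. \<psi> x - \<psi> y) = pd i \<psi>" for i
      by (rule ext) (simp add: pd_diff Ck_scalar_2D[OF \<psi>] pd_const)
    show ?thesis
      by (rule jet_bound_vanishing[of _ L y])
         (use that L lip \<psi> in \<open>auto simp: e1 pd1 pd2 intro: Ck_scalar_diff Ck_scalar_const\<close>)
  qed
  have cubic: "\<bar>\<psi> x - \<psi> y\<bar> \<le> 4 * L * d ^ 3" if "y \<in> K" "norm (x - y) \<le> d" for x y d
    using near[OF that] by (simp add: jet_bound_def)

  \<comment> \<open>Total length \<open>r0 ^ 3\<close> means that collapsing moves values by no more
    than the order of the other errors at scale \<open>r0\<close>.\<close>
  obtain S and \<rho> :: real where S: "finite S" "0 < \<rho>" "card S * (4 * \<rho>) \<le> r0 ^ 3" "\<forall>y\<in>K. \<exists>c\<in>S. \<bar>\<psi> y - c\<bar> \<le> \<rho>"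
    using ex_image_cover[of K R \<psi> "4 * L" "r0 ^ 3"] K R L r0(1) cubic by auto
  obtain h where h: "h 0 = 0" "\<And>s t. \<bar>h s - h t\<bar> \<le> \<bar>s - t\<bar>" "\<And>t. \<bar>h t - t\<bar> \<le> card S * (4 * \<rho>)"
    "\<And>c s t. c \<in> S \<Longrightarrow> \<bar>s - c\<bar> < 2 * \<rho> \<Longrightarrow> \<bar>t - c\<bar> < 2 * \<rho> \<Longrightarrow> h s = h t"
    using ex_collapse[OF S(1,2)] by metis
  define H where "H x = h (\<psi> x)" for x
  have H_near: "\<bar>H x - H y\<bar> \<le> 4 * L * d ^ 3" if "y \<in> K" "norm (x - y) \<le> d" for x y d
    using h(2)[of "\<psi> x" "\<psi> y"] cubic[OF that] by (simp add: H_def)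
  have H_\<psi>: "\<bar>H x - \<psi> x\<bar> \<le> r0 ^ 3" for x
    using h(3)[of "\<psi> x"] S(3) by (simp add: H_def)

  \<comment> \<open>The added 1 makes the inequality in \<open>N\<close> strict, as
    \<open>interp_shift_jet_bound_iff\<close> requires. The ball of radius \<open>R + 10\<close>
    contains all points within \<open>5 * r k\<close> of \<open>K\<close>.\<close>
  define N where "N k = nat \<lceil>(R + 10) / r k\<rceil> + 1" for k
  have N: "\<bar>x $ i\<bar> < N k * r k" if "norm x \<le> R + 10" for x :: "real^2" and i k
  proof -
    have "(R + 10) / r k < N k" unfolding N_def using of_nat_ceiling[of "(R + 10) / r k"] by simp
    then have "R + 10 < N k * r k" using r(1)[of k] by (simp add: pos_divide_less_eq)
    then show ?thesis using that component_le_norm_cart[of x i] by linarith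
  qed
  define E where "E k = interp (N k) (r k) H" for k
  \<comment> \<open>Interpolation looks at values up to distance \<open>2 * r k\<close>. Starting
    from the indicator of the \<open>3 * r k\<close> neighbourhood, the cutoff
    \<open>\<zeta> k\<close> is 1 within \<open>r k\<close> of \<open>K\<close> and 0 beyond
    \<open>5 * r k\<close>, in both cases with vanishing derivatives up to order two.\<close>
  define A where "A k = (\<lambda>z. if \<exists>y\<in>K. norm (z - y) \<le> 3 * r k then 1 else 0 :: real)" for k
  define \<zeta> where "\<zeta> k = interp (N k) (r k) (A k)" for k
  have smooth: "Ck_scalar l (E k)" "Ck_scalar l (\<zeta> k)" for l k
    unfolding E_def \<zeta>_def by (rule Ck_scalar_interp)+
  have E_bd: "jet_bound (r k) (C2 * M) (\<lambda>x. E k x - c) x"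
    if "norm x \<le> R + 10" "0 \<le> M" "\<And>z. norm (x - z) \<le> 2 * r k \<Longrightarrow> \<bar>H z - c\<bar> \<le> M" for x k M c
    unfolding E_def interp_shift_jet_bound_iff[OF r(1) N[OF that(1)]]
    using that r by (intro C2(2)[rule_format]) auto
  have \<zeta>_bd: "jet_bound (r k) C2 (\<zeta> k) x" for k x
  proof -
    have "jet_bound (r k) (C2 * 1) (\<zeta> k) x"
      unfolding \<zeta>_def using r by (intro C2(2)[rule_format]) (auto simp: A_def)
    then show ?thesis by simp
  qed
  have \<zeta>_0: "jet_bound (r k) 0 (\<zeta> k) x" if "\<And>y. y \<in> K \<Longrightarrow> norm (x - y) > 5 * r k" for k x
  proof -
    have "A k z = 0" if z: "norm (x - z) \<le> 2 * r k" for z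
    proof -
      have "norm (z - y) > 3 * r k" if "y \<in> K" for y
        using \<open>\<And>y. y \<in> K \<Longrightarrow> norm (x - y) > 5 * r k\<close>[OF that] z norm_triangle_ineq[of "x - z" "z - y"] by simp
      then show ?thesis by (force simp: A_def)
    qed
    then have "jet_bound (r k) (C2 * 0) (\<zeta> k) x"
      unfolding \<zeta>_def using r by (intro C2(2)[rule_format]) auto
    then show ?thesis by simp
  qed
  have \<zeta>_1: "jet_bound (r k) 0 (\<lambda>x. \<zeta> k x - 1) x" if y: "y \<in> K" "norm (x - y) \<le> r k" for k x y
  proof -
    have x: "norm x \<le> R + 10"
      using K[OF y(1)] y(2) r(3)[of k] norm_triangle_ineq[of "x - y" y] by simp
    have "A k z = 1" if z: "norm (x - z) \<le> 2 * r k" for z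
    proof -
      have "norm (z - y) \<le> 3 * r k"
        using y z norm_triangle_ineq[of "z - x" "x - y"] by (simp add: norm_minus_commute)
      then show ?thesis using y by (force simp: A_def)
    qed
    then have "jet_bound (r k) (C2 * 0) (interp (N k) (r k) (\<lambda>z. A k z - 1)) x"
      using r by (intro C2(2)[rule_format]) auto
    then show ?thesis unfolding \<zeta>_def interp_shift_jet_bound_iff[OF r(1) N[OF x]] by simp
  qed

  obtain T where T: "\<And>k. Ck_scalar k T" "\<And>x. norm x > R + 2 * r0 \<Longrightarrow> T x = 0"
    "\<And>x. jet_bound r0 (C1 * L * r0 ^ 3) (\<lambda>x. T x - \<psi> x) x"
    using C1(2)[rule_format, OF \<psi> L lip supp r0(1)] by blast

  \<comment> \<open>If \<open>x\<close> is within \<open>d\<close> of \<open>y\<close> in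
    \<open>K\<close>, then \<open>\<psi> x\<close> is within \<open>\<rho>\<close> of
    \<open>\<psi> y\<close>, hence within \<open>2 * \<rho>\<close> of a point of \<open>S\<close>.
    This is why the intervals in \<open>ex_collapse\<close> have radius
    \<open>2 * \<rho>\<close>.\<close>
  obtain d where d: "0 < d" "d \<le> 1" "4 * L * d ^ 3 < \<rho>"
  proof
    define d where "d = min 1 (\<rho> / (4 * L + 1))"
    have d: "0 < d" "d \<le> 1" using S(2) L by (auto simp: d_def)
    have "d ^ 3 \<le> d ^ 1" using d by (intro power_decreasing) auto
    then have "4 * L * d ^ 3 \<le> 4 * L * d" using L by (simp add: mult_left_mono)
    also have "\<dots> < (4 * L + 1) * d" using d by (simp add: algebra_simps)
    also have "\<dots> \<le> (4 * L + 1) * (\<rho> / (4 * L + 1))" using L by (intro mult_left_mono) (auto simp: d_def)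
    also have "\<dots> = \<rho>" using L by simp
    finally show "4 * L * d ^ 3 < \<rho>" .
    show "0 < d" "d \<le> 1" by fact+
  qed
  have H_const: "H x = H y" if y: "y \<in> K" "norm (x - y) \<le> d" for x y
  proof -
    obtain c where c: "c \<in> S" "\<bar>\<psi> y - c\<bar> \<le> \<rho>" using S(4) y(1) by blast
    have "\<bar>\<psi> x - \<psi> y\<bar> < \<rho>" using cubic[OF y] d(3) by linarith
    then show ?thesis unfolding H_def using c S(2) by (intro h(4)[of c]) auto
  qed
  \<comment> \<open>Within \<open>r n\<close> of \<open>K\<close> the interpolant \<open>E n\<close>
    samples \<open>H\<close> only at distance at most \<open>3 * r n\<close> from \<open>K\<close>,
    where \<open>H\<close> takes a single value.\<close>
  obtain n where n: "3 * r n \<le> d"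
  proof -
    obtain n where "3 * r0 / d < 2 ^ n" using real_arch_pow[of 2 "3 * r0 / d"] by auto
    then have "3 * r n \<le> d" using d(1) by (simp add: r_def field_simps)
    then show ?thesis by (rule that)
  qed

  \<comment> \<open>Where all cutoffs are 1 the sum defining \<open>\<Psi>\<close> telescopes to
    \<open>E n\<close>; where all are 0 it is \<open>T\<close>.\<close>
  define F where "F k x = \<zeta> (Suc k) x * (E (Suc k) x - E k x)" for k x
  define \<Psi> where "\<Psi> x = T x + \<zeta> 0 x * (E 0 x - T x) + (\<Sum>k<n. F k x)" for x
  have F: "Ck_scalar l (F k)" for l k
    unfolding F_def by (intro Ck_scalar_mult Ck_scalar_diff smooth)
  have F0: "Ck_scalar l (\<lambda>x. \<zeta> 0 x * (E 0 x - T x))" for l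
    by (intro Ck_scalar_mult Ck_scalar_diff smooth T)
  have \<Psi>: "Ck_scalar l \<Psi>" for l
    unfolding \<Psi>_def by (intro Ck_scalar_add Ck_scalar_sum F F0 T)

  have supp_\<Psi>: "\<Psi> x = 0" if x: "norm x > R + 10" for x
  proof -
    have "norm (x - y) > 5 * r k" if "y \<in> K" for y k
      using K[OF that] x r(3)[of k] norm_triangle_ineq2[of x y] by linarith
    then have "\<zeta> k x = 0" for k using \<zeta>_0[of k x] by (simp add: jet_bound_def)
    moreover have "T x = 0" using T(2) x r0 by simp
    ultimately show ?thesis by (simp add: \<Psi>_def F_def)
  qed

  \<comment> \<open>As \<open>r n \<le> r k\<close>, every cutoff with index up to \<open>n\<close>
    equals 1 to first order at \<open>x\<close>. The gradients telescope to that of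
    \<open>E n\<close>, which is zero.\<close>
  have grad: "pd i \<Psi> x = 0" if y: "y \<in> K" "norm (x - y) < r n" for x y i
  proof -
    have x: "norm x \<le> R + 10"
      using K[OF y(1)] y(2) r(3)[of n] norm_triangle_ineq[of "x - y" y] by simp
    note dif = Ck_scalar_2D(1)[OF smooth(1)[of 2]] Ck_scalar_2D(1)[OF smooth(2)[of 2]] Ck_scalar_2D(1)[OF T(1)[of 2]]
      Ck_scalar_2D(1)[OF F[of 2]] Ck_scalar_2D(1)[OF F0[of 2]]
    have z: "\<zeta> k x = 1" "pd i (\<zeta> k) x = 0" if "k \<le> n" for k
    proof -
      have "jet_bound (r k) 0 (\<lambda>x. \<zeta> k x - 1) x" using \<zeta>_1[OF y(1)] y(2) r_mono[OF that] by simp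
      then have "\<zeta> k x - 1 = 0" "pd i (\<lambda>x. \<zeta> k x - 1) x = 0"
        using r(1)[of k] by (auto simp: jet_bound_def mult_le_0_iff dest!: spec[of _ i])
      then show "\<zeta> k x = 1" "pd i (\<zeta> k) x = 0" by (auto simp: pd_diff pd_const dif)
    qed
    have "H z = H y" if z: "norm (x - z) \<le> 2 * r n" for z
    proof (rule H_const[OF y(1)])
      show "norm (z - y) \<le> d"
        using y z n norm_triangle_ineq[of "z - x" "x - y"] by (simp add: norm_minus_commute)
    qed
    then have "jet_bound (r n) (C2 * 0) (\<lambda>x. E n x - H y) x" using x by (intro E_bd) auto
    then have "pd i (\<lambda>x. E n x - H y) x = 0"
      using r(1)[of n] by (auto simp: jet_bound_def mult_le_0_iff dest!: spec[of _ i])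
    then have En: "pd i (E n) x = 0" by (simp add: pd_diff pd_const dif)
    have "pd i (F k) x = pd i (E (Suc k)) x - pd i (E k) x" if "k < n" for k
      unfolding F_def using z[of "Suc k"] that by (simp add: pd_mult pd_diff dif)
    moreover have "pd i (\<lambda>x. \<zeta> 0 x * (E 0 x - T x)) x = pd i (E 0) x - pd i T x"
      using z[of 0] by (simp add: pd_mult pd_diff dif)
    ultimately have "pd i \<Psi> x = pd i T x + (pd i (E 0) x - pd i T x) + (\<Sum>k<n. pd i (E (Suc k)) x - pd i (E k) x)"
      unfolding \<Psi>_def by (simp add: pd_add pd_sum dif differentiable_sum)
    also have "\<dots> = 0" using En sum_lessThan_telescope[of "\<lambda>k. pd i (E k) x" n] by simp
    finally show ?thesis .
  qed

  \<comment> \<open>Far from \<open>K\<close> the cutoff has zero two-jet. Near \<open>K\<close>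
    both interpolants are compared with the constant \<open>H y\<close>: the weighted bound is cubic
    in \<open>r (Suc k)\<close>, and unscaling leaves a linear one.\<close>
  have F_bd: "jet_bound 1 (D1 * r (Suc k)) (F k) x" for k x
  proof (cases "\<exists>y\<in>K. norm (x - y) \<le> 5 * r (Suc k)")
    case False
    then have "jet_bound (r (Suc k)) 0 (F k) x" unfolding F_def
      using r(1)[of "Suc k"] by (intro jet_bound_mult_0 smooth Ck_scalar_diff \<zeta>_0) (force simp: not_le)+
    then have "jet_bound 1 0 (F k) x" using jet_bound_unscale[OF _ r(1,3)] by fastforce
    then show ?thesis using nn r(1)[of "Suc k"] by (elim jet_bound_mono) simp
  next
    case True
    then obtain y where y: "y \<in> K" "norm (x - y) \<le> 5 * r (Suc k)" by blast
    let ?s = "r (Suc k)"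
    have x: "norm x \<le> R + 10"
      using K[OF y(1)] y(2) r(3)[of "Suc k"] norm_triangle_ineq[of "x - y" y] by simp
    \<comment> \<open>\<open>4 * ?s\<close> is the sampling radius \<open>2 * r k\<close> of the
      coarser interpolant; together with the distance \<open>5 * ?s\<close> to \<open>y\<close> it
      gives the 9 behind \<open>B\<close>.\<close>
    have H: "\<bar>H z - H y\<bar> \<le> B * ?s ^ 3" if "norm (x - z) \<le> 4 * ?s" for z
    proof -
      have "norm (z - y) \<le> 9 * ?s"
        using that y norm_triangle_ineq[of "z - x" "x - y"] by (simp add: norm_minus_commute)
      from H_near[OF y(1) this] show ?thesis by (simp add: B_def power_mult_distrib)
    qed
    have M: "0 \<le> B * ?s ^ 3" using nn r(1)[of "Suc k"] by simp
    have "jet_bound ?s (C2 * (B * ?s ^ 3)) (\<lambda>x. E (Suc k) x - H y) x"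
      using H r(1)[of "Suc k"] by (intro E_bd x M) auto
    moreover have "jet_bound (r k) (C2 * (B * ?s ^ 3)) (\<lambda>x. E k x - H y) x"
      by (intro E_bd x M H) (simp add: r(4))
    then have "jet_bound ?s (C2 * (B * ?s ^ 3)) (\<lambda>x. E k x - H y) x"
      using r(1)[of k] r(4)[of k] by (elim jet_bound_scale) auto
    ultimately have "jet_bound ?s (C2 * (B * ?s ^ 3) + C2 * (B * ?s ^ 3))
        (\<lambda>x. (E (Suc k) x - H y) - (E k x - H y)) x"
      using r(1)[of "Suc k"] by (intro jet_bound_diff Ck_scalar_diff smooth Ck_scalar_const) auto
    then have "jet_bound ?s (4 * C2 * (C2 * (B * ?s ^ 3) + C2 * (B * ?s ^ 3))) (F k) x"
      unfolding F_def using r(1)[of "Suc k"] \<zeta>_bd by (intro jet_bound_mult Ck_scalar_diff smooth) auto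
    from jet_bound_unscale[OF this r(1,3)] show ?thesis
      using r(1)[of "Suc k"] by (simp add: D1_def power2_eq_square power3_eq_cube ac_simps)
  qed

  have F0_bd: "jet_bound 1 (D0 * r0) (\<lambda>x. \<zeta> 0 x * (E 0 x - T x)) x" for x
  proof (cases "\<exists>y\<in>K. norm (x - y) \<le> 5 * r 0")
    case False
    then have "jet_bound (r 0) 0 (\<lambda>x. \<zeta> 0 x * (E 0 x - T x)) x"
      using r(1)[of 0] by (intro jet_bound_mult_0 smooth T Ck_scalar_diff \<zeta>_0) (force simp: not_le)+
    then have "jet_bound 1 0 (\<lambda>x. \<zeta> 0 x * (E 0 x - T x)) x" using jet_bound_unscale[OF _ r(1,3)] by fastforce
    then show ?thesis using nn r0 by (elim jet_bound_mono) simp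
  next
    case True
    have rr: "r 0 = r0" by (simp add: r_def)
    obtain y where y: "y \<in> K" "norm (x - y) \<le> 5 * r0" using True rr by auto
    have x: "norm x \<le> R + 10"
      using K[OF y(1)] y(2) r0 norm_triangle_ineq[of "x - y" y] by simp
    have H: "\<bar>H z - H y\<bar> \<le> B * r0 ^ 3" if "norm (x - z) \<le> 2 * r0" for z
    proof -
      have "norm (z - y) \<le> 9 * r0"
        using that y norm_triangle_ineq[of "z - x" "x - y"] r0 by (simp add: norm_minus_commute)
      from H_near[OF y(1) this] show ?thesis by (simp add: B_def power_mult_distrib)
    qed
    have M: "0 \<le> B * r0 ^ 3" using nn r0 by simp
    have 1: "jet_bound r0 (C2 * (B * r0 ^ 3)) (\<lambda>x. E 0 x - H y) x"
      using E_bd[OF x M, of 0 "H y"] H rr by simp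
    have "jet_bound (9 * r0) (B * r0 ^ 3) (\<lambda>x. \<psi> x - \<psi> y) x"
      using near[OF y(1), of x "9 * r0"] y(2) r0 by (simp add: B_def power_mult_distrib mult.assoc)
    then have 2: "jet_bound r0 (B * r0 ^ 3) (\<lambda>x. \<psi> x - \<psi> y) x"
      using r0 by (elim jet_bound_scale) auto
    have 3: "jet_bound r0 (r0 ^ 3) (\<lambda>x. H y - \<psi> y) x"
      using H_\<psi> by (rule jet_bound_const)
    \<comment> \<open>\<open>E 0 - T\<close> is split so that \<open>E 0\<close> is compared with
      \<open>H y\<close>, \<open>\<psi>\<close> with \<open>\<psi> y\<close>, and \<open>T\<close>
      with \<open>\<psi>\<close>. The constant \<open>H y - \<psi> y\<close> accounts for the
      collapse and has no derivatives.\<close>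
    have "jet_bound r0 (C2 * (B * r0 ^ 3) + B * r0 ^ 3 + r0 ^ 3 + C1 * L * r0 ^ 3)
        (\<lambda>x. (E 0 x - H y) - (\<psi> x - \<psi> y) + (H y - \<psi> y) - (T x - \<psi> x)) x"
      using 1 2 3 T(3) r0(1)
      by (intro jet_bound_diff[of "\<lambda>x. _ x + _ x"] jet_bound_diff[of "\<lambda>x. E 0 x - H y"] jet_bound_add
          Ck_scalar_add Ck_scalar_diff smooth Ck_scalar_const T(1) \<psi>) auto
    then have "jet_bound r0 (4 * C2 * (C2 * (B * r0 ^ 3) + B * r0 ^ 3 + r0 ^ 3 + C1 * L * r0 ^ 3))
        (\<lambda>x. \<zeta> 0 x * (E 0 x - T x)) x"
      using \<zeta>_bd[of 0] rr r0(1) by (intro jet_bound_mult Ck_scalar_diff smooth T) auto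
    from jet_bound_unscale[OF this r0] show ?thesis
    proof (rule jet_bound_mono)
      show "4 * C2 * (C2 * (B * r0 ^ 3) + B * r0 ^ 3 + r0 ^ 3 + C1 * L * r0 ^ 3) / r0\<^sup>2 \<le> D0 * r0"
        using r0(1) by (simp add: D0_def power2_eq_square power3_eq_cube divide_le_eq) (simp add: algebra_simps)
    qed
  qed

  have "jet_bound 1 \<epsilon> (\<lambda>x. \<Psi> x - \<psi> x) x" for x
  proof -
    have "jet_bound 1 (C1 * L * r0) (\<lambda>x. T x - \<psi> x) x"
      using jet_bound_unscale[OF T(3) r0, of x] r0(1) by (simp add: power2_eq_square power3_eq_cube mult.assoc)
    moreover have "jet_bound 1 (\<Sum>k<n. D1 * r (Suc k)) (\<lambda>x. \<Sum>k<n. F k x) x"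
      by (intro jet_bound_sum F F_bd) auto
    ultimately have *: "jet_bound 1 (C1 * L * r0 + D0 * r0 + (\<Sum>k<n. D1 * r (Suc k)))
        (\<lambda>x. (T x - \<psi> x) + \<zeta> 0 x * (E 0 x - T x) + (\<Sum>k<n. F k x)) x"
      using F0_bd[of x] by (intro jet_bound_add Ck_scalar_add Ck_scalar_sum Ck_scalar_diff F F0 T \<psi>) auto
    \<comment> \<open>The geometric series bounds the sum independently of \<open>n\<close>, which
      was chosen after \<open>r0\<close> and may be large.\<close>
    have "(\<Sum>k<n. D1 * r (Suc k)) \<le> D1 * r0"
      unfolding sum_distrib_left[symmetric] r_def using nn sum_half_powers_le[of r0 n] r0
      by (intro mult_left_mono) auto
    then have "C1 * L * r0 + D0 * r0 + (\<Sum>k<n. D1 * r (Suc k)) \<le> \<epsilon>"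
      using r0D by (simp add: D_def algebra_simps)
    from jet_bound_mono[OF * this] show ?thesis by (simp add: \<Psi>_def algebra_simps)
  qed
  then show ?thesis using \<Psi> supp_\<Psi> grad r(1)[of n] by blast
qed

section \<open>Stream functions\<close>

definition pt :: "real \<Rightarrow> real \<Rightarrow> real^2" where
  "pt a b = vector [a, b]"

lemma pt_nth [simp]: "pt a b $ 1 = a" "pt a b $ 2 = b"
  by (simp_all add: pt_def)

lemma pt_eta: "pt (x $ 1) (x $ 2) = x"
  by (simp add: vec_eq_iff forall_2)

lemma pt_line: "pt a b = pt 0 b + a *\<^sub>R axis 1 1" "pt a b = pt a 0 + b *\<^sub>R axis 2 1"
  by (auto simp: vec_eq_iff forall_2 axis_def)

lemma norm_pt_ge: "\<bar>a\<bar> \<le> norm (pt a b)" "\<bar>b\<bar> \<le> norm (pt a b)"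
  using component_le_norm_cart[of "pt a b" 1] component_le_norm_cart[of "pt a b" 2] by simp_all

lemma continuous_on_pt:
  assumes "continuous_on S f" "continuous_on S g"
  shows "continuous_on S (\<lambda>x. pt (f x) (g x))"
proof -
  have "pt (f x) (g x) = f x *\<^sub>R axis 1 1 + g x *\<^sub>R axis 2 1" for x
    by (simp add: vec_eq_iff forall_2 axis_def)
  then show ?thesis using assms by (auto intro!: continuous_intros)
qed

text \<open>\<open>\<phi> a b\<close> integrates \<open>v\<close> along the vertical line through
  \<open>a\<close>. Its derivative in \<open>b\<close> is \<open>v\<close>; differentiating under
  the integral and replacing \<open>pd 1 v\<close> by \<open>- pd 2 w\<close> gives
  \<open>- w\<close> as its derivative in \<open>a\<close>.\<close>

lemma ex_stream_function:
  fixes v w :: "real^2 \<Rightarrow> real"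
  assumes v: "Ck_scalar 1 v" and w: "Ck_scalar 1 w"
    and div: "\<And>x. pd 1 v x + pd 2 w x = 0"
    and supp: "\<And>x. norm x > R \<Longrightarrow> v x = 0" "\<And>x. norm x > R \<Longrightarrow> w x = 0" and R: "0 \<le> R"
  shows "\<exists>\<psi>. (\<forall>x. \<psi> differentiable at x) \<and> pd 2 \<psi> = v \<and> pd 1 \<psi> = (\<lambda>x. - w x) \<and>
    (\<forall>x. norm x > 2 * R + 2 \<longrightarrow> \<psi> x = 0)"
proof -
  \<comment> \<open>The integration starts strictly below the support. Thus \<open>\<phi>\<close> is
    zero on an open half-line containing every \<open>b \<le> - S\<close>, and its derivative there
    needs no one-sided argument.\<close>
  define S where "S = R + 1"
  define \<phi> where "\<phi> a b = integral {-S..b} (\<lambda>t. v (pt a t))" for a b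
  have dif: "v differentiable at x" "w differentiable at x"
    and cont: "continuous_on UNIV (pd j v)" "continuous_on UNIV (pd j w)" for x j
    using Ck_scalar_1D[OF v] Ck_scalar_1D[OF w] by auto
  note cv = Ck_scalar_continuous[OF v] and cw = Ck_scalar_continuous[OF w]
  have cpt: "continuous_on A (pt a)" for A a
    by (intro continuous_on_pt continuous_intros)
  have cvt: "continuous_on A (\<lambda>t. v (pt a t))" for A a
    by (rule continuous_on_compose2[OF cv cpt]) simp
  have D1: "((\<lambda>a. f (pt a b)) has_real_derivative pd 1 f (pt a b)) (at a)"
    if "\<And>x. f differentiable at x" for f a b
    using DERIV_line[of f "pt 0 b" a 1] that unfolding pt_line(1)[symmetric] by simp
  have D2: "((\<lambda>b. f (pt a b)) has_real_derivative pd 2 f (pt a b)) (at b)"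
    if "\<And>x. f differentiable at x" for f a b
    using DERIV_line[of f "pt a 0" b 2] that unfolding pt_line(2)[symmetric] by simp
  have \<phi>b: "((\<lambda>b. \<phi> a b) has_real_derivative v (pt a b)) (at b)" for a b
  proof (cases "b > - S")
    case True
    have "((\<lambda>b. \<phi> a b) has_vector_derivative v (pt a b)) (at b within {-S..b + 1})"
      unfolding \<phi>_def using True by (intro integral_has_vector_derivative cvt) auto
    moreover have "at b within {-S..b + 1} = at b"
      using True by (intro at_within_interior) (simp add: interior_atLeastAtMost_real)
    ultimately show ?thesis by (simp add: has_real_derivative_iff_has_vector_derivative)
  next
    case False
    have 0: "v (pt a t) = 0" if "t < - R" for t
      using that norm_pt_ge(2)[of t a] R by (intro supp) linarith
    have "((\<lambda>b. \<phi> a b) has_real_derivative 0) (at b)"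
    proof (rule has_field_derivative_transform_within_open[of "\<lambda>_. 0" 0 b "{..<- R}"])
      show "0 = \<phi> a t" if "t \<in> {..<- R}" for t
        unfolding \<phi>_def using that by (subst integral_cong[of _ _ "\<lambda>_. 0"]) (auto intro!: 0)
    qed (use False in \<open>auto simp: S_def\<close>)
    then show ?thesis using 0[of b] False by (simp add: S_def)
  qed
  have \<phi>a: "((\<lambda>a. \<phi> a b) has_real_derivative - w (pt a b)) (at a)" for a b
  proof -
    have "((\<lambda>a. integral (cbox (-S) b) (\<lambda>t. v (pt a t))) has_field_derivative
        integral (cbox (-S) b) (\<lambda>t. pd 1 v (pt a t))) (at a within UNIV)"
    proof (rule leibniz_rule_field_derivative)
      show "continuous_on (UNIV \<times> cbox (-S) b) (\<lambda>(a, t). pd 1 v (pt a t))"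
        unfolding split_beta
        by (rule continuous_on_compose2[OF cont(1) continuous_on_pt]) (auto intro!: continuous_intros)
    qed (auto intro!: D1 dif integrable_continuous_real cvt)
    moreover have "integral {-S..b} (\<lambda>t. pd 1 v (pt a t)) = - w (pt a b)"
    proof (cases "-S \<le> b")
      case True
      have "((\<lambda>t. - w (pt a t)) has_vector_derivative - pd 2 w (pt a t)) (at t within {-S..b})" for t
        unfolding has_real_derivative_iff_has_vector_derivative[symmetric]
        by (rule has_field_derivative_at_within[OF DERIV_minus[OF D2[OF dif(2)]]])
      then have "((\<lambda>t. - pd 2 w (pt a t)) has_integral (- w (pt a b) - (- w (pt a (-S))))) {-S..b}"
        using True by (intro fundamental_theorem_of_calculus)
      moreover have "- pd 2 w x = pd 1 v x" for x using div[of x] by linarith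
      moreover have "w (pt a (-S)) = 0"
        using norm_pt_ge(2)[of "-S" a] R by (intro supp) (simp add: S_def)
      ultimately show ?thesis by (simp add: integral_unique)
    next
      case False
      then have "w (pt a b) = 0"
        using norm_pt_ge(2)[of b a] R by (intro supp) (simp add: S_def)
      then show ?thesis using False by simp
    qed
    ultimately show ?thesis by (simp add: \<phi>_def)
  qed
  \<comment> \<open>Partial derivatives alone do not give total differentiability; joint continuity
    of the partial derivative in \<open>b\<close> does.\<close>
  have total: "((\<lambda>(a, b). \<phi> a b) has_derivative (\<lambda>(h, k). - w (pt a b) * h + v (pt a b) * k)) (at (a, b))" for a b
  proof -
    have "((\<lambda>(a, b). \<phi> a b) has_derivative
        (\<lambda>(h, k). - w (pt a b) * h + blinfun_mult_right (v (pt a b)) k)) (at (a, b) within UNIV \<times> UNIV)"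
    proof (rule has_derivative_partialsI)
      show "((\<lambda>a. \<phi> a b) has_derivative (*) (- w (pt a b))) (at a within UNIV)"
        using \<phi>a by (simp add: has_field_derivative_def)
      show "((\<lambda>b. \<phi> a b) has_derivative blinfun_apply (blinfun_mult_right (v (pt a b)))) (at b within UNIV)" for a b
        using \<phi>b[of a b] by (simp add: has_field_derivative_def)
      have "continuous_on UNIV (\<lambda>p. v (pt (fst p) (snd p)))"
        by (rule continuous_on_compose2[OF cv continuous_on_pt]) (auto intro!: continuous_intros)
      then have "continuous_on UNIV (\<lambda>p. blinfun_mult_right (v (pt (fst p) (snd p))))"
        by (rule bounded_linear.continuous_on[OF bounded_linear_blinfun_mult_right])
      then show "continuous (at (a, b) within UNIV \<times> UNIV) (\<lambda>(a, b). blinfun_mult_right (v (pt a b)))"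
        by (simp add: case_prod_unfold continuous_on_eq_continuous_at)
    qed auto
    then show ?thesis by simp
  qed
  define \<psi> where "\<psi> x = \<phi> (x $ 1) (x $ 2)" for x :: "real^2"
  have \<psi>: "(\<psi> has_derivative (\<lambda>h. - w x * h $ 1 + v x * h $ 2)) (at x)" for x
  proof -
    have "((\<lambda>x::real^2. (x $ 1, x $ 2)) has_derivative (\<lambda>h. (h $ 1, h $ 2))) (at x)"
      by (intro has_derivative_Pair bounded_linear_imp_has_derivative bounded_linear_vec_nth)
    from has_derivative_compose[OF this total] show ?thesis
      by (simp add: \<psi>_def[abs_def] pt_eta)
  qed
  have "pd 2 \<psi> = v" "pd 1 \<psi> = (\<lambda>x. - w x)"
    using pd_eqI[OF \<psi>] by (auto simp: axis_def)
  moreover have "\<psi> x = 0" if x: "norm x > 2 * R + 2" for x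
  proof -
    have far: "\<phi> a b = 0" if "\<bar>a\<bar> > S" for a b
    proof -
      have "v (pt a t) = 0" for t using that norm_pt_ge(1)[of a t] by (intro supp) (simp add: S_def)
      then show ?thesis by (simp add: \<phi>_def)
    qed
    have "\<bar>x $ 1\<bar> > S \<or> \<bar>x $ 2\<bar> > S" using x norm_le_2[of x] by (auto simp: S_def)
    then consider "\<bar>x $ 1\<bar> > S" | "x $ 2 < - S" | "x $ 2 > S" by linarith
    then show ?thesis
    proof cases
      case 1
      then show ?thesis by (simp add: \<psi>_def far)
    next
      case 2
      then show ?thesis by (simp add: \<psi>_def \<phi>_def)
    next
      \<comment> \<open>Above the support \<open>w\<close> vanishes on the whole horizontal line, so
        \<open>\<phi>\<close> is constant in its first argument; it is zero at \<open>S + 1\<close>,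
        beyond the support of \<open>v\<close>.\<close>
      case 3
      have "w (pt a (x $ 2)) = 0" for a
        using 3 R norm_pt_ge(2)[of "x $ 2" a] by (intro supp) (simp add: S_def)
      then have "\<phi> (x $ 1) (x $ 2) = \<phi> (S + 1) (x $ 2)"
        using \<phi>a[of "x $ 2"] by (intro DERIV_isconst_all) simp
      also have "\<dots> = 0" using R by (intro far) (simp add: S_def)
      finally show ?thesis by (simp add: \<psi>_def)
    qed
  qed
  ultimately show ?thesis using \<psi> unfolding differentiable_def by blast
qed

section \<open>The approximation theorem\<close>

lemma jacobian_nth:
  fixes u :: "real^'n \<Rightarrow> real^'m"
  assumes "\<And>i. (\<lambda>x. u x $ i) differentiable at x"
  shows "jacobian u (at x) $ i $ j = pd j (\<lambda>x. u x $ i) x"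
proof -
  have "u differentiable at x"
    using assms unfolding differentiable_componentwise_within[of u x UNIV]
    by (auto simp: Basis_vec_def inner_axis)
  then have "(u has_derivative frechet_derivative u (at x)) (at x)"
    by (simp add: frechet_derivative_works)
  then have "((\<lambda>x. u x $ i) has_derivative (\<lambda>h. frechet_derivative u (at x) h $ i)) (at x)"
    by (rule bounded_linear.has_derivative[OF bounded_linear_vec_nth])
  from pd_eqI[OF this, of j] show ?thesis by (simp add: jacobian_def matrix_def)
qed

text \<open>The gradient is bounded because it is continuous with compact support. The lemma
  supplies the Lipschitz constant of the second derivatives of the stream function.\<close>

lemma ex_lipschitz_compact_support:
  fixes g :: "real^'n \<Rightarrow> real"
  assumes "Ck_scalar 1 g" "\<And>x. norm x > R \<Longrightarrow> g x = 0"
  shows "\<exists>L\<ge>0. \<forall>x z. \<bar>g x - g z\<bar> \<le> L * norm (x - z)"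
proof -
  have "\<exists>B\<ge>0. \<forall>x. \<bar>pd j g x\<bar> \<le> B" for j
    using assms(2) pd_eq_0_outside[of R g]
    by (intro bounded_compact_support[of _ R] Ck_scalar_1D(2)[OF assms(1)]) auto
  then obtain B where B: "\<And>j. B j \<ge> 0" "\<And>j x. \<bar>pd j g x\<bar> \<le> B j" by metis
  have "\<bar>pd j g x\<bar> \<le> sum B UNIV" for j x
    using B member_le_sum[of j UNIV B] by (meson UNIV_I finite order_trans)
  then have "\<bar>g x - g z\<bar> \<le> CARD('n) * sum B UNIV * norm (x - z)" for x z
    using Ck_scalar_1D(1)[OF assms(1)] by (intro abs_diff_le_pd[of UNIV]) auto
  then show ?thesis
    using B(1) by (intro exI[of _ "CARD('n) * sum B UNIV"]) (auto intro!: mult_nonneg_nonneg sum_nonneg)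
qed

lemma norm_matrix_le:
  fixes A :: "real^'n^'m"
  shows "norm A \<le> (\<Sum>i\<in>UNIV. \<Sum>j\<in>UNIV. \<bar>A $ i $ j\<bar>)"
proof -
  have "norm A \<le> (\<Sum>i\<in>UNIV. norm (A $ i))"
    unfolding norm_vec_def[of A] by (rule L2_set_le_sum) simp
  also have "\<dots> \<le> (\<Sum>i\<in>UNIV. \<Sum>j\<in>UNIV. \<bar>A $ i $ j\<bar>)"
    by (intro sum_mono norm_le_l1_cart)
  finally show ?thesis .
qed

theorem theorem1p4:
  fixes K :: "(real^2) set" and u :: "real^2 \<Rightarrow> real^2"
  assumes "compact K"
    and "Ck 2 u" and "compact (supp u)"
    and "\<forall>x. divergence u x = 0"
    and "\<forall>x\<in>K. u x = 0"
    and "\<forall>x\<in>K. jacobian u (at x) = 0"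
  shows "\<exists>uk :: nat \<Rightarrow> real^2 \<Rightarrow> real^2.
           (\<forall>k. C_infinity (uk k) \<and> compact (supp (uk k))
                \<and> (\<forall>x. divergence (uk k) x = 0)
                \<and> supp (uk k) \<subseteq> UNIV - K)
         \<and> uniform_limit UNIV uk u sequentially
         \<and> uniform_limit UNIV (\<lambda>k x. jacobian (uk k) (at x)) (\<lambda>x. jacobian u (at x)) sequentially"
proof -
  obtain R where R: "0 \<le> R" "\<And>x. norm x > R \<Longrightarrow> u x = 0" "\<And>y. y \<in> K \<Longrightarrow> norm y \<le> R"
  proof -
    have "bounded (supp u \<union> K)" using assms(1,3) by (simp add: compact_imp_bounded)
    then obtain b where b: "\<And>x. x \<in> supp u \<union> K \<Longrightarrow> norm x \<le> b" unfolding bounded_iff by blast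
    have "u x = 0" if "norm x > \<bar>b\<bar>" for x
      using that b[of x] closure_subset[of "{x. u x \<noteq> 0}"] by (auto simp: supp_def)
    moreover have "norm y \<le> \<bar>b\<bar>" if "y \<in> K" for y using b[of y] that by simp
    ultimately show ?thesis using that[of "\<bar>b\<bar>"] by simp
  qed
  define v where "v x = u x $ 1" for x
  define w where "w x = u x $ 2" for x
  have vw: "Ck_scalar 2 v" "Ck_scalar 2 w"
    using assms(2) by (auto simp: Ck_def v_def[abs_def] w_def[abs_def])
  have u_dif: "(\<lambda>x. u x $ i) differentiable at x" for i x
    using assms(2) Ck_scalar_2D(1) by (auto simp: Ck_def)
  have jac: "jacobian u (at x) $ 1 $ j = pd j v x" "jacobian u (at x) $ 2 $ j = pd j w x" for x j
    using jacobian_nth[OF u_dif] by (simp_all add: v_def[abs_def] w_def[abs_def])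
  have div: "pd 1 v x + pd 2 w x = 0" for x
    using assms(4) by (simp add: divergence_def trace_def sum_2 jac)
  have vw1: "Ck_scalar 1 v" "Ck_scalar 1 w" using vw by (auto intro: Ck_scalar_mono)
  obtain \<psi> where \<psi>: "\<And>x. \<psi> differentiable at x" "pd 2 \<psi> = v" "pd 1 \<psi> = (\<lambda>x. - w x)"
    "\<And>x. norm x > 2 * R + 2 \<Longrightarrow> \<psi> x = 0"
    using ex_stream_function[OF vw1 div, of R] R by (auto simp: v_def w_def)
  have pdw: "pd j (\<lambda>x. - w x) = (\<lambda>x. - pd j w x)" for j
    by (rule ext) (simp add: pd_minus Ck_scalar_2D[OF vw(2)])
  have \<psi>2: "Ck_scalar 2 (pd j \<psi>)" for j
  proof -
    have "\<forall>j. Ck_scalar 2 (pd j \<psi>)" unfolding forall_2 using vw by (simp add: \<psi> Ck_scalar_minus)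
    then show ?thesis ..
  qed
  have \<psi>_C2: "Ck_scalar 2 \<psi>"
    using \<psi>(1) \<psi>2 by (auto simp: numeral_2_eq_2 Ck_scalar_Suc[of "Suc 0"] intro: Ck_scalar_SucD)
  have pd1: "pd i \<psi> y = 0" if "y \<in> K" for i y
  proof -
    have "\<forall>i. pd i \<psi> y = 0" unfolding forall_2 using assms(5) that by (simp add: \<psi> v_def w_def)
    then show ?thesis ..
  qed
  have pd2: "pd i (pd j \<psi>) y = 0" if "y \<in> K" for i j y
  proof -
    have "jacobian u (at y) = 0" using assms(6) that by blast
    then have "pd i v y = 0" "pd i w y = 0" for i using jac[of y i] by simp_all
    then have "\<forall>j. pd i (pd j \<psi>) y = 0" unfolding forall_2 by (simp add: \<psi> pdw)
    then show ?thesis ..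
  qed
  \<comment> \<open>Since \<open>u\<close> is C^2, \<open>\<psi>\<close> is C^3, so its second
    derivatives are C^1 with compact support.\<close>
  have "\<exists>L\<ge>0. \<forall>x z. \<bar>pd i (pd j \<psi>) x - pd i (pd j \<psi>) z\<bar> \<le> L * norm (x - z)" for i j
  proof (rule ex_lipschitz_compact_support)
    show "Ck_scalar 1 (pd i (pd j \<psi>))" using \<psi>2[of j] by (simp add: numeral_2_eq_2 Ck_scalar_Suc)
    show "pd i (pd j \<psi>) x = 0" if "norm x > 2 * R + 2" for x
      using that pd_eq_0_outside[of "2 * R + 2" "pd j \<psi>"] pd_eq_0_outside[of "2 * R + 2" \<psi>] \<psi>(4) by blast
  qed
  then obtain l where l: "\<And>i j. l i j \<ge> 0"
    "\<And>i j x z. \<bar>pd i (pd j \<psi>) x - pd i (pd j \<psi>) z\<bar> \<le> l i j * norm (x - z)" by metis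
  define L where "L = (\<Sum>i\<in>UNIV. \<Sum>j\<in>UNIV. l i j)"
  have "l i j \<le> L" for i j
    unfolding L_def using l(1) member_le_sum[of j UNIV "l i"] member_le_sum[of i UNIV "\<lambda>i. \<Sum>j\<in>UNIV. l i j"]
    by (simp add: sum_nonneg)
  then have lip: "\<bar>pd i (pd j \<psi>) x - pd i (pd j \<psi>) z\<bar> \<le> L * norm (x - z)" for i j x z
    using l(2)[of i j x z] mult_right_mono[of "l i j" L "norm (x - z)"] by fastforce
  have L: "0 \<le> L" unfolding L_def using l(1) by (intro sum_nonneg)
  define Q where "Q = 2 * R + 2"
  have Q: "0 \<le> Q" "\<And>y. y \<in> K \<Longrightarrow> norm y \<le> Q" using R(1) R(3) by (auto simp: Q_def intro: order_trans[of _ R])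
  \<comment> \<open>All conclusions are packed into one predicate, so that a single choice yields
    both sequences \<open>\<Psi>\<close> and \<open>e\<close>, with tolerance 1/(n+1).\<close>
  define good where "good n \<Psi> e \<longleftrightarrow> (\<forall>k. Ck_scalar k \<Psi>) \<and> (\<forall>x. norm x > Q + 10 \<longrightarrow> \<Psi> x = 0) \<and>
    0 < e \<and> (\<forall>x y i. y \<in> K \<longrightarrow> norm (x - y) < e \<longrightarrow> pd i \<Psi> x = 0) \<and>
    (\<forall>x. jet_bound 1 (1 / real (Suc n)) (\<lambda>x. \<Psi> x - \<psi> x) x)" for n \<Psi> e
  have "\<exists>\<Psi> e. good n \<Psi> e" for n
    unfolding good_def using \<psi>(4) Q pd1 pd2
    by (intro ex_locally_constant_approx[OF \<psi>_C2 L lip]) (auto simp: Q_def)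
  then obtain \<Psi> e where "\<And>n. good n (\<Psi> n) (e n)" by metis
  then have \<Psi>: "\<And>n k. Ck_scalar k (\<Psi> n)" "\<And>n x. norm x > Q + 10 \<Longrightarrow> \<Psi> n x = 0"
    and e: "\<And>n. 0 < e n" "\<And>n x y i. y \<in> K \<Longrightarrow> norm (x - y) < e n \<Longrightarrow> pd i (\<Psi> n) x = 0"
    and close: "\<And>n x. jet_bound 1 (1 / real (Suc n)) (\<lambda>x. \<Psi> n x - \<psi> x) x"
    unfolding good_def by blast+
  \<comment> \<open>The rotated gradient of \<open>\<Psi> n\<close>: divergence free by symmetry of
    second derivatives, and zero wherever the gradient of \<open>\<Psi> n\<close> is.\<close>
  define U where "U n x = pt (pd 2 (\<Psi> n) x) (- pd 1 (\<Psi> n) x)" for n x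
  have pd\<Psi>: "Ck_scalar k (pd j (\<Psi> n))" for n k j
    using \<Psi>(1)[of "Suc k" n] by (simp add: Ck_scalar_Suc)
  have U_nth: "(\<lambda>x. U n x $ 1) = pd 2 (\<Psi> n)" "(\<lambda>x. U n x $ 2) = (\<lambda>x. - pd 1 (\<Psi> n) x)" for n
    by (simp_all add: U_def)
  have U_Ck: "\<forall>i. Ck_scalar k (\<lambda>x. U n x $ i)" for n k
    unfolding forall_2 U_nth using pd\<Psi> Ck_scalar_minus by blast
  have U_jac: "jacobian (U n) (at x) $ i $ j = pd j (\<lambda>x. U n x $ i) x" for n x i j
    using U_Ck[of 2 n] by (intro jacobian_nth Ck_scalar_2D(1)) simp
  have pdU2: "pd j (\<lambda>x. - pd 1 (\<Psi> n) x) x = - pd j (pd 1 (\<Psi> n)) x" for j n x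
    by (simp add: pd_minus Ck_scalar_2D[OF \<Psi>(1)])
  have diff: "\<bar>pd i (\<Psi> n) x - pd i \<psi> x\<bar> \<le> 1 / real (Suc n)"
    "\<bar>pd i (pd j (\<Psi> n)) x - pd i (pd j \<psi>) x\<bar> \<le> 1 / real (Suc n)" for n x i j
  proof -
    have 1: "pd i (\<lambda>x. \<Psi> n x - \<psi> x) = (\<lambda>x. pd i (\<Psi> n) x - pd i \<psi> x)" for i
      by (rule ext) (simp add: pd_diff Ck_scalar_2D[OF \<Psi>(1)] \<psi>(1))
    have 2: "pd i (pd j (\<lambda>x. \<Psi> n x - \<psi> x)) x = pd i (pd j (\<Psi> n)) x - pd i (pd j \<psi>) x" for i j
      unfolding 1 by (simp add: pd_diff Ck_scalar_2D[OF \<Psi>(1)] Ck_scalar_2D[OF \<psi>_C2])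
    show "\<bar>pd i (\<Psi> n) x - pd i \<psi> x\<bar> \<le> 1 / real (Suc n)"
      using close[of n x] unfolding jet_bound_def 1 by simp
    show "\<bar>pd i (pd j (\<Psi> n)) x - pd i (pd j \<psi>) x\<bar> \<le> 1 / real (Suc n)"
      using close[of n x] unfolding jet_bound_def 2 by simp
  qed
  have U_close: "norm (U n x - u x) \<le> 4 / real (Suc n)" for n x
  proof -
    have "norm (U n x - u x) \<le> \<bar>pd 2 (\<Psi> n) x - pd 2 \<psi> x\<bar> + \<bar>pd 1 (\<Psi> n) x - pd 1 \<psi> x\<bar>"
      using norm_le_2[of "U n x - u x"] by (simp add: U_def \<psi> v_def w_def abs_minus_commute)
    then have "norm (U n x - u x) \<le> 2 * (1 / real (Suc n))" using diff(1)[where n = n and x = x, of 1] diff(1)[where n = n and x = x, of 2] by linarith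
    \<comment> \<open>The 2 is weakened to 4 to share the rate of the Jacobians, which have four
      entries.\<close>
    also have "\<dots> \<le> 4 * (1 / real (Suc n))" by (intro mult_right_mono) auto
    finally show ?thesis by simp
  qed
  have J_close: "norm (jacobian (U n) (at x) - jacobian u (at x)) \<le> 4 / real (Suc n)" for n x
  proof -
    have "\<bar>(jacobian (U n) (at x) - jacobian u (at x)) $ 1 $ j\<bar> \<le> 1 / real (Suc n)" for j
      using diff(2)[where n = n and x = x, of j 2] by (simp add: U_jac U_nth jac \<psi>)
    moreover have "\<bar>(jacobian (U n) (at x) - jacobian u (at x)) $ 2 $ j\<bar> \<le> 1 / real (Suc n)" for j
      using diff(2)[where n = n and x = x, of j 1] by (simp add: U_jac U_nth pdU2 jac \<psi> pdw abs_minus_commute)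
    ultimately have "(\<Sum>i\<in>UNIV. \<Sum>j\<in>UNIV. \<bar>(jacobian (U n) (at x) - jacobian u (at x)) $ i $ j\<bar>)
        \<le> (1 / real (Suc n) + 1 / real (Suc n)) + (1 / real (Suc n) + 1 / real (Suc n))"
      unfolding sum_2 by (intro add_mono)
    then show ?thesis
      using norm_matrix_le[of "jacobian (U n) (at x) - jacobian u (at x)"] by simp
  qed
  have limit: "uniform_limit UNIV f g sequentially"
    if "\<And>n x. norm (f n x - g x) \<le> 4 / real (Suc n)"
    for f :: "nat \<Rightarrow> real^2 \<Rightarrow> 'a::real_normed_vector" and g
  proof (rule uniform_limitI)
    fix \<epsilon> :: real assume "\<epsilon> > 0"
    have "(\<lambda>n. 4 * inverse (real (Suc n))) \<longlonglongrightarrow> 4 * 0"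
      by (intro tendsto_intros LIMSEQ_inverse_real_of_nat)
    then have "\<forall>\<^sub>F n in sequentially. 4 / real (Suc n) < \<epsilon>"
      using order_tendstoD(2)[of "\<lambda>n. 4 * inverse (real (Suc n))" 0 sequentially \<epsilon>] \<open>\<epsilon> > 0\<close>
      by (simp add: divide_inverse)
    then show "\<forall>\<^sub>F n in sequentially. \<forall>x\<in>UNIV. dist (f n x) (g x) < \<epsilon>"
      by (rule eventually_mono) (use that in \<open>auto simp: dist_norm intro: le_less_trans\<close>)
  qed
  have "compact (supp (U n))" for n
  proof -
    have "{x. U n x \<noteq> 0} \<subseteq> cball 0 (Q + 10)"
    proof
      fix x assume "x \<in> {x. U n x \<noteq> 0}"
      moreover have "U n x = 0" if "norm x > Q + 10"
        using pd_eq_0_outside[of "Q + 10" "\<Psi> n"] \<Psi>(2) that by (simp add: U_def vec_eq_iff forall_2)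
      ultimately show "x \<in> cball 0 (Q + 10)" by (auto simp: not_less[symmetric])
    qed
    then have "bounded {x. U n x \<noteq> 0}" using bounded_subset bounded_cball by blast
    then show ?thesis by (simp add: supp_def)
  qed
  moreover have "supp (U n) \<subseteq> UNIV - K" for n
  proof -
    \<comment> \<open>\<open>U n\<close> vanishes on the ball of radius \<open>e n\<close> about
      each point of \<open>K\<close>, so even the closure of its nonzero set misses
      \<open>K\<close>.\<close>
    have "y \<notin> K" if y: "y \<in> supp (U n)" for y
    proof
      assume "y \<in> K"
      obtain x where "U n x \<noteq> 0" "dist x y < e n"
        using y e(1)[of n] unfolding supp_def closure_approachable by blast
      moreover from this have "pd i (\<Psi> n) x = 0" for i using e(2)[OF \<open>y \<in> K\<close>] by (simp add: dist_norm)
      ultimately show False by (simp add: U_def vec_eq_iff forall_2)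
    qed
    then show ?thesis by blast
  qed
  moreover have "divergence (U n) x = 0" for n x
    using pd_commute[OF \<Psi>(1), of 1 2 n x]
    by (simp add: divergence_def trace_def sum_2 U_jac U_nth pdU2)
  moreover have "C_infinity (U n)" for n
    using U_Ck by (simp add: C_infinity_def Ck_def)
  moreover have "uniform_limit UNIV U u sequentially" using U_close by (rule limit)
  moreover have "uniform_limit UNIV (\<lambda>n x. jacobian (U n) (at x)) (\<lambda>x. jacobian u (at x)) sequentially"
    using J_close by (rule limit)
  ultimately show ?thesis by blast
qed

end
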